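(* If $G$ is a finite simple undirected AT-free graph, then $\mathrm{cub}(G) \le \mathrm{box}(G)\,(\lceil \log_2 \psi(G)\rceil + 2) \le \chi(G)\,(\lceil \log_2 \psi(G)\rceil + 2)$, where $\chi(G)$ is the chromatic number of $G$.
   Context: $G$ is AT-free if it has no asteroidal triple (independent set of three vertices such that between each pair there is a path avoiding the neighbourhood of the third). $\mathrm{box}(G)$ (resp. $\mathrm{cub}(G)$) is the minimum $k$ such that $G$ is the intersection graph of axis-parallel boxes (resp. unit cubes) in $\mathbb{R}^k$, equivalently the minimum $k$ such that $G$ is the edge-intersection of $k$ interval graphs (resp. unit interval graphs) on $V(G)$. $S(k)$ denotes the star $K_{1,k}$; the claw number $\psi(G)$ is the largest positive integer $k$ such that $S(k)$ is an induced subgraph of $G$. *)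

theory Defs
  imports
    Complex_Main
    "HOL-Library.FuncSet"
    "Graph_Theory.Digraph_Component"
    "Graph_Theory.Vertex_Walk"
    "Graph_Theory.Kuratowski"
begin

definition neighbourhood :: "('a, 'b) pre_digraph \<Rightarrow> 'a \<Rightarrow> 'a set" where
  "neighbourhood G w = {v. w \<rightarrow>\<^bsub>G\<^esub> v}"

definition independent_set :: "('a, 'b) pre_digraph \<Rightarrow> 'a set \<Rightarrow> bool" where
  "independent_set G S \<longleftrightarrow> S \<subseteq> verts G \<and> (\<forall>u\<in>S. \<forall>v\<in>S. \<not> u \<rightarrow>\<^bsub>G\<^esub> v)"

definition asteroidal_triple :: "('a, 'b) pre_digraph \<Rightarrow> 'a set \<Rightarrow> bool" where
  "asteroidal_triple G T \<longleftrightarrow>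
     card T = 3 \<and> independent_set G T \<and>
     (\<forall>u\<in>T. \<forall>v\<in>T. \<forall>w\<in>T. u \<noteq> v \<and> u \<noteq> w \<and> v \<noteq> w \<longrightarrow>
        (\<exists>p. vpath p G \<and> hd p = u \<and> last p = v \<and> set p \<inter> neighbourhood G w = {}))"

definition AT_free :: "('a, 'b) pre_digraph \<Rightarrow> bool" where
  "AT_free G \<longleftrightarrow> (\<nexists>T. asteroidal_triple G T)"

text \<open>
  Points of $\mathbb{R}^k$ are the functions in \<^term>\<open>{..<k} \<rightarrow>\<^sub>E (UNIV :: real set)\<close>.
  In particular $\mathbb{R}^0$ is a single point, so that complete graphs have boxicity and
  cubicity \<^term>\<open>0::nat\<close>.
\<close>

definition axis_parallel_box :: "nat \<Rightarrow> (nat \<Rightarrow> real) set \<Rightarrow> bool" where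
  "axis_parallel_box k B \<longleftrightarrow>
     (\<exists>a b. (\<forall>i<k. a i \<le> b i) \<and> B = (\<Pi>\<^sub>E i\<in>{..<k}. {a i..b i}))"

definition unit_cube :: "nat \<Rightarrow> (nat \<Rightarrow> real) set \<Rightarrow> bool" where
  "unit_cube k B \<longleftrightarrow> (\<exists>a. B = (\<Pi>\<^sub>E i\<in>{..<k}. {a i..a i + 1}))"

definition intersection_graph_of :: "('a, 'b) pre_digraph \<Rightarrow> ('a \<Rightarrow> 'c set) \<Rightarrow> bool" where
  "intersection_graph_of G f \<longleftrightarrow>
     (\<forall>u\<in>verts G. \<forall>v\<in>verts G. u \<noteq> v \<longrightarrow> (u \<rightarrow>\<^bsub>G\<^esub> v \<longleftrightarrow> f u \<inter> f v \<noteq> {}))"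

definition boxicity :: "('a, 'b) pre_digraph \<Rightarrow> nat" where
  "boxicity G =
     (LEAST k. \<exists>f. (\<forall>v\<in>verts G. axis_parallel_box k (f v)) \<and> intersection_graph_of G f)"

definition cubicity :: "('a, 'b) pre_digraph \<Rightarrow> nat" where
  "cubicity G =
     (LEAST k. \<exists>f. (\<forall>v\<in>verts G. unit_cube k (f v)) \<and> intersection_graph_of G f)"

text \<open>
  An edgeless graph contains no star \<^term>\<open>K\<^bsub>1,k\<^esub>\<close> with \<^term>\<open>k > (0::nat)\<close>; the supremum
  then is \<^term>\<open>0::nat\<close>. For every finite graph with an edge it is a maximum.
\<close>

definition claw_number :: "('a, 'b) pre_digraph \<Rightarrow> nat" where
  "claw_number G = Sup {k. 0 < k \<and> (\<exists>H. induced_subgraph H G \<and> K\<^bsub>1,k\<^esub> H)}"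

definition chromatic_number :: "('a, 'b) pre_digraph \<Rightarrow> nat" where
  "chromatic_number G =
     (LEAST k. \<exists>c. c \<in> verts G \<rightarrow> {..<k} \<and> (\<forall>u v. u \<rightarrow>\<^bsub>G\<^esub> v \<longrightarrow> c u \<noteq> c v))"

end

theory Submission
  imports Defs
begin

text \<open>
  Let \<open>G\<close> be AT-free, \<open>J\<close> a chordal supergraph of \<open>G\<close> and \<open>H\<close> a minimal chordal graph between
  them. If the neighbours in \<open>G\<close> of a set \<open>X\<close> outside \<open>X\<close> form a clique \<open>S\<close> of \<open>H\<close>, then by
  minimality \<open>H\<close> has no edges from \<open>X\<close> to the complement of \<open>X \<union> S\<close>. Hence an asteroidal triple
  of \<open>H\<close> would be one of \<open>G\<close> (Moehring), so \<open>H\<close> is an interval graph (Lekkerkerker and Boland),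
  and for the same reason the leaves of a claw of \<open>H\<close> can be replaced one by one by neighbours in
  \<open>G\<close> of its centre, so that \<open>H\<close> has no larger claws than \<open>G\<close>.

  For the chromatic number take for \<open>J\<close>, for each colour, the split graph obtained from \<open>G\<close> by
  making the complement of the colour class a clique; these graphs intersect in \<open>G\<close>. For the
  cubicity take for \<open>J\<close> the interval graphs of the coordinates of a box representation. Let \<open>h v\<close>
  be the length of a longest chain of intervals of \<open>H\<close> to the left of \<open>v\<close>. If all claws have at
  most \<open>2 ^ t\<close> leaves, then \<open>h\<close> differs by at most \<open>2 ^ t\<close> on adjacent vertices. Disjoint intervals
  whose heights lie in the same block of length \<open>2 ^ t\<close> are separated by the \<open>t\<close> binary digits of
  \<open>h\<close>, those in different blocks by two further coordinates.
\<close>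

section \<open>Connected sets, cliques and separators\<close>

text \<open>A coordinate of a box representation may have many more edges than \<open>G\<close> and
  claws unrelated to those of \<open>G\<close>. Passing to a minimal chordal graph below it controls
  the claws, and it is enough to stay between \<open>G\<close> and \<open>J\<close>, because the
  \<open>J\<close> of all coordinates intersect in \<open>G\<close>. The obstacle to gluing interval
  representations at a clique separator is that a separator may split off a single vertex, so that
  one piece is as large as the whole graph and induction makes no progress. Such vertices must go to
  the ends of the representation. An AT-free graph has at most two of them, and they are set aside
  before the separator is chosen. The summand 2 arises as follows. A unit coordinate that separates
  disjoint intervals of two consecutive blocks of heights has to place the blocks at distance 1. It
  cannot do so for all consecutive pairs at once, because intersecting intervals must stay within
  distance 1. So one coordinate serves the steps after even blocks and the other those after odd
  blocks.\<close>

definition conn :: "('a \<Rightarrow> 'a \<Rightarrow> bool) \<Rightarrow> 'a set \<Rightarrow> 'a \<Rightarrow> 'a \<Rightarrow> bool" where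
  "conn E X = (\<lambda>a b. E a b \<and> a \<in> X \<and> b \<in> X)\<^sup>*\<^sup>*"

definition component :: "('a \<Rightarrow> 'a \<Rightarrow> bool) \<Rightarrow> 'a set \<Rightarrow> 'a \<Rightarrow> 'a set" where
  "component E X x = {y. conn E X x y}"

definition connected_set :: "('a \<Rightarrow> 'a \<Rightarrow> bool) \<Rightarrow> 'a set \<Rightarrow> bool" where
  "connected_set E F \<longleftrightarrow> (\<forall>x\<in>F. \<forall>y\<in>F. conn E F x y)"

definition clique :: "('a \<Rightarrow> 'a \<Rightarrow> bool) \<Rightarrow> 'a set \<Rightarrow> bool" where
  "clique E S \<longleftrightarrow> (\<forall>x\<in>S. \<forall>y\<in>S. x \<noteq> y \<longrightarrow> E x y)"

text \<open>Reflexivity holds for every \<open>x\<close>, also outside \<open>X\<close>; hence the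
  premise \<open>x \<in> X\<close> in \<open>component_subset\<close> and its consequences.\<close>

lemma conn_refl [simp]: "conn E X x x"
  by (simp add: conn_def)

lemma conn_trans: "conn E X x y \<Longrightarrow> conn E X y z \<Longrightarrow> conn E X x z"
  unfolding conn_def by (rule rtranclp_trans)

lemma conn_edge: "E x y \<Longrightarrow> x \<in> X \<Longrightarrow> y \<in> X \<Longrightarrow> conn E X x y"
  unfolding conn_def by blast

lemma conn_step: "conn E X x y \<Longrightarrow> E y z \<Longrightarrow> y \<in> X \<Longrightarrow> z \<in> X \<Longrightarrow> conn E X x z"
  by (meson conn_edge conn_trans)

lemma conn_sym:
  assumes "symp E" "conn E X x y"
  shows "conn E X y x"
proof -
  have "symp (\<lambda>a b. E a b \<and> a \<in> X \<and> b \<in> X)"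
    using assms(1) by (auto simp: symp_def)
  then have "symp (conn E X)"
    unfolding conn_def by (rule symp_rtranclp)
  then show ?thesis
    using assms(2) by (rule sympD)
qed

lemma conn_mono:
  assumes "conn E X x y" "X \<subseteq> Y" "\<And>a b. E a b \<Longrightarrow> F a b"
  shows "conn F Y x y"
  using assms(1) unfolding conn_def
  by (rule rtranclp_mono[THEN predicate2D, rotated]) (use assms in auto)

lemma conn_subset: "conn E X x y \<Longrightarrow> X \<subseteq> Y \<Longrightarrow> conn E Y x y"
  by (rule conn_mono)

lemma conn_closed:
  assumes "conn E X x y" "x \<in> A" "\<And>a b. a \<in> A \<Longrightarrow> b \<in> X \<Longrightarrow> E a b \<Longrightarrow> b \<in> A"
  shows "y \<in> A"
  using assms(1) unfolding conn_def
  by (induction rule: rtranclp_induct) (use assms in auto)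

lemma conn_exit:
  assumes "conn E X x y" "x \<in> A" "y \<notin> A"
  obtains a b where "a \<in> A" "a \<in> X" "b \<in> X" "b \<notin> A" "E a b"
proof -
  have "\<exists>a b. a \<in> A \<and> a \<in> X \<and> b \<in> X \<and> b \<notin> A \<and> E a b"
    using assms(1,3) unfolding conn_def
    by (induction rule: rtranclp_induct) (use assms(2) in auto)
  then show ?thesis
    using that by blast
qed

lemma component_self [simp]: "x \<in> component E X x"
  by (simp add: component_def)

lemma component_subset: "x \<in> X \<Longrightarrow> component E X x \<subseteq> X"
  unfolding component_def using conn_closed[of E X x _ X] by auto

lemma component_step:
  "y \<in> component E X x \<Longrightarrow> x \<in> X \<Longrightarrow> E y z \<Longrightarrow> z \<in> X \<Longrightarrow> z \<in> component E X x"
  using component_subset[of x X E] unfolding component_def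
  by (auto intro: conn_step)

lemma conn_component:
  assumes "conn E X x y" "x \<in> X"
  shows "conn E (component E X x) x y"
proof -
  have "y \<in> {y. y \<in> component E X x \<and> conn E (component E X x) x y}"
    by (rule conn_closed[OF assms(1)]) (auto intro: conn_step component_step[OF _ assms(2)])
  then show ?thesis by simp
qed

lemma connected_component:
  assumes "symp E" "x \<in> X"
  shows "connected_set E (component E X x)"
  unfolding connected_set_def
  using conn_component[OF _ assms(2), of E] conn_sym[OF assms(1)] conn_trans
  unfolding component_def by (metis (lifting) mem_Collect_eq)

lemma component_eqI:
  assumes "symp E" "y \<in> component E X x"
  shows "component E X y = component E X x"
  using assms conn_sym[OF assms(1)] unfolding component_def by (auto intro: conn_trans)

lemma connected_singleton [simp]: "connected_set E {x}"
  by (simp add: connected_set_def)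

lemma connected_union:
  assumes "symp E" "connected_set E A" "connected_set E B" "a \<in> A" "b \<in> B" "a = b \<or> E a b"
  shows "connected_set E (A \<union> B)"
proof -
  have A: "conn E (A \<union> B) x y" if "x \<in> A" "y \<in> A" for x y
    using assms(2) that unfolding connected_set_def by (blast intro: conn_subset)
  have B: "conn E (A \<union> B) x y" if "x \<in> B" "y \<in> B" for x y
    using assms(3) that unfolding connected_set_def by (blast intro: conn_subset)
  have ab: "conn E (A \<union> B) a b"
    using assms(4,5,6) by (auto intro: conn_edge)
  have "conn E (A \<union> B) x a" if "x \<in> A \<union> B" for x
    using A B conn_sym[OF assms(1) ab] assms(4,5) that by (blast intro: conn_trans)
  then show ?thesis
    unfolding connected_set_def by (blast intro: conn_trans conn_sym[OF assms(1)])
qed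

lemma connected_insert:
  assumes "symp E" "connected_set E B" "b \<in> B" "E a b"
  shows "connected_set E (insert a B)"
  using connected_union[OF assms(1) connected_singleton assms(2), of a a b] assms by simp

lemma connected_exit:
  assumes "connected_set E F" "x \<in> F" "y \<in> F" "x \<in> A" "y \<notin> A"
  obtains a b where "a \<in> A" "a \<in> F" "b \<in> F" "b \<notin> A" "E a b"
  using conn_exit[of E F x y A] assms unfolding connected_set_def by metis

lemma clique_subset: "clique E S \<Longrightarrow> S' \<subseteq> S \<Longrightarrow> clique E S'"
  unfolding clique_def by blast

section \<open>Clique separators, chordal graphs and asteroidal triples\<close>

definition separated :: "'a set \<Rightarrow> ('a \<Rightarrow> 'a \<Rightarrow> bool) \<Rightarrow> 'a \<Rightarrow> 'a \<Rightarrow> bool" where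
  "separated V E u v \<longleftrightarrow> (\<exists>A T. A \<subseteq> V \<and> T \<subseteq> V \<and> A \<inter> T = {} \<and> u \<in> A \<and> v \<in> V - A - T \<and>
     clique E T \<and> (\<forall>x\<in>A. \<forall>y\<in>V - A - T. \<not> E x y))"

text \<open>Chordality, stated as Dirac's criterion: cliques separate all non-adjacent vertices.\<close>

definition chordal :: "'a set \<Rightarrow> ('a \<Rightarrow> 'a \<Rightarrow> bool) \<Rightarrow> bool" where
  "chordal V E \<longleftrightarrow> (\<forall>u\<in>V. \<forall>v\<in>V. u \<noteq> v \<and> \<not> E u v \<longrightarrow> separated V E u v)"

definition at_free :: "'a set \<Rightarrow> ('a \<Rightarrow> 'a \<Rightarrow> bool) \<Rightarrow> bool" where
  "at_free V E \<longleftrightarrow> \<not> (\<exists>x\<in>V. \<exists>y\<in>V. \<exists>z\<in>V. x \<noteq> y \<and> x \<noteq> z \<and> y \<noteq> z \<and>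
     \<not> E x y \<and> \<not> E x z \<and> \<not> E y z \<and>
     conn E {v\<in>V. \<not> E z v} x y \<and> conn E {v\<in>V. \<not> E y v} x z \<and> conn E {v\<in>V. \<not> E x v} y z)"

lemma separatedI:
  assumes "A \<subseteq> V" "T \<subseteq> V" "A \<inter> T = {}" "u \<in> A" "v \<in> V" "v \<notin> A" "v \<notin> T" "clique E T"
    "\<And>x y. x \<in> A \<Longrightarrow> y \<in> V \<Longrightarrow> y \<notin> A \<Longrightarrow> y \<notin> T \<Longrightarrow> \<not> E x y"
  shows "separated V E u v"
  unfolding separated_def using assms by (intro exI[of _ A] exI[of _ T]) auto

lemma separated_sym:
  assumes "symp E" "separated V E u v"
  shows "separated V E v u"
proof -
  obtain A T where AT: "A \<subseteq> V" "T \<subseteq> V" "A \<inter> T = {}" "u \<in> A" "v \<in> V - A - T" "clique E T"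
    "\<forall>x\<in>A. \<forall>y\<in>V - A - T. \<not> E x y"
    using assms(2) unfolding separated_def by blast
  show ?thesis
    by (rule separatedI[of "V - A - T" V T]) (use AT in \<open>auto dest: sympD[OF assms(1)]\<close>)
qed

lemma chordal_subset:
  assumes "chordal V E" "W \<subseteq> V"
  shows "chordal W E"
  unfolding chordal_def
proof (intro ballI impI)
  fix u v assume uv: "u \<in> W" "v \<in> W" "u \<noteq> v \<and> \<not> E u v"
  then have "separated V E u v"
    using assms unfolding chordal_def by blast
  then obtain A T where AT: "A \<subseteq> V" "T \<subseteq> V" "A \<inter> T = {}" "u \<in> A" "v \<in> V - A - T" "clique E T"
    "\<forall>x\<in>A. \<forall>y\<in>V - A - T. \<not> E x y"
    unfolding separated_def by blast
  show "separated W E u v"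
    by (rule separatedI[of "A \<inter> W" W "T \<inter> W"])
      (use AT uv assms(2) in \<open>auto intro: clique_subset\<close>)
qed

lemma at_free_subset:
  assumes "at_free V E" "W \<subseteq> V"
  shows "at_free W E"
proof -
  have "conn E {v\<in>V. \<not> E z v} x y" if "conn E {v\<in>W. \<not> E z v} x y" for x y z
    using that by (rule conn_subset) (use assms in auto)
  then show ?thesis
    using assms unfolding at_free_def by blast
qed

text \<open>Connected sets take the place of paths: later they are components joined through one or
  two vertices, so no path has to be written down.\<close>

lemma at_freeD:
  assumes "at_free V E" "x \<in> V" "y \<in> V" "z \<in> V" "x \<noteq> y" "x \<noteq> z" "y \<noteq> z"
    "\<not> E x y" "\<not> E x z" "\<not> E y z"
    and "connected_set E P" "x \<in> P" "y \<in> P" "P \<subseteq> V" "\<And>p. p \<in> P \<Longrightarrow> \<not> E z p"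
    and "connected_set E Q" "x \<in> Q" "z \<in> Q" "Q \<subseteq> V" "\<And>p. p \<in> Q \<Longrightarrow> \<not> E y p"
    and "connected_set E R" "y \<in> R" "z \<in> R" "R \<subseteq> V" "\<And>p. p \<in> R \<Longrightarrow> \<not> E x p"
  shows False
proof -
  have "conn E P x y" "conn E Q x z" "conn E R y z"
    using assms unfolding connected_set_def by blast+
  then have "conn E {v\<in>V. \<not> E z v} x y" "conn E {v\<in>V. \<not> E y v} x z" "conn E {v\<in>V. \<not> E x v} y z"
    by (auto elim!: conn_subset simp: assms(14,15,19,20,24,25) subset_eq intro: assms(14,19,24)[THEN subsetD])
  then show False
    using assms(1-10) unfolding at_free_def by blast
qed

text \<open>Otherwise \<open>z\<close>, \<open>s\<close>, a shortest path through \<open>C\<close> and \<open>t\<close> would form a chordless cycle.\<close>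

lemma chordal_common_neighbours_adjacent:
  assumes E: "symp E" "chordal V E"
    and C: "connected_set E C" "C \<subseteq> V" "z \<notin> C" "\<And>c. c \<in> C \<Longrightarrow> \<not> E z c"
    and st: "s \<in> V" "t \<in> V" "z \<in> V" "s \<noteq> t" "E z s" "E z t"
    and nb: "c \<in> C" "E s c" "d \<in> C" "E t d"
  shows "E s t"
proof (rule ccontr)
  assume "\<not> E s t"
  then obtain A T where AT: "A \<subseteq> V" "T \<subseteq> V" "A \<inter> T = {}" "s \<in> A" "t \<in> V - A - T" "clique E T"
    "\<forall>x\<in>A. \<forall>y\<in>V - A - T. \<not> E x y"
    using E(2) st unfolding chordal_def separated_def by meson
  have sym: "\<And>x y. E x y \<Longrightarrow> E y x"
    using E(1) by (rule sympD)
  \<comment> \<open>\<open>z\<close> has neighbours on both sides of the separator, so it lies in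
    \<open>T\<close>. All other vertices of the clique \<open>T\<close> are then neighbours of
    \<open>z\<close>, which keeps \<open>C\<close> out of \<open>T\<close>; but the connected set
    \<open>C\<close> touches both sides.\<close>
  have zT: "z \<in> T"
    using AT(4,5,7) st(3,6) sym[OF st(5)] by blast
  have noCT: "C \<inter> T = {}"
  proof -
    have "E z x" if "x \<in> T" "x \<noteq> z" for x
      using zT AT(6) that unfolding clique_def by metis
    then show ?thesis
      using C(3,4) by (metis disjoint_iff)
  qed
  have "c \<in> A"
    using AT nb(1,2) C(2) noCT by blast
  moreover have "d \<notin> A"
    using AT(5,7) sym[OF nb(4)] by blast
  ultimately obtain a b where "a \<in> A" "a \<in> C" "b \<in> C" "b \<notin> A" "E a b"
    using connected_exit[OF C(1) nb(1,3)] by metis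
  then show False
    using AT(7) C(2) noCT by blast
qed

text \<open>Take \<open>b\<close> in \<open>F\<close> with the most neighbours in \<open>T\<close>.
  If \<open>b\<close> misses \<open>t\<close>, leave the component of \<open>b\<close> among the
  non-neighbours of \<open>t\<close> in \<open>F\<close> by an edge to \<open>g\<close>. Then
  \<open>g\<close> is adjacent to \<open>t\<close> and, by
  \<open>chordal_common_neighbours_adjacent\<close> at \<open>t\<close>, to all neighbours of
  \<open>b\<close> in \<open>T\<close>, against the choice of \<open>b\<close>.\<close>

lemma ex_complete_vertex:
  assumes E: "symp E" "chordal V E" and fin: "finite V"
    and F: "connected_set E F" "F \<subseteq> V" "F \<noteq> {}"
    and T: "clique E T" "T \<subseteq> V" "F \<inter> T = {}" "\<And>t. t \<in> T \<Longrightarrow> \<exists>f\<in>F. E t f"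
  obtains b where "b \<in> F" "\<And>t. t \<in> T \<Longrightarrow> E b t"
proof -
  have sym: "\<And>x y. E x y \<Longrightarrow> E y x"
    using E(1) by (rule sympD)
  have finT: "finite T" using T(2) fin finite_subset by blast
  define w where "w b = card {t\<in>T. E b t}" for b
  obtain b where b: "b \<in> F" "\<And>f. f \<in> F \<Longrightarrow> w f \<le> w b"
  proof -
    have "finite F" using F(2) fin by (rule finite_subset)
    then have "Max (w ` F) \<in> w ` F" "\<And>f. f \<in> F \<Longrightarrow> w f \<le> Max (w ` F)"
      using F(3) by auto
    then show ?thesis using that by (metis imageE)
  qed
  have "E b t" if t: "t \<in> T" for t
  proof (rule ccontr)
    assume nb: "\<not> E b t"
    define X where "X = {f\<in>F. \<not> E t f}"
    define C where "C = component E X b"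
    have bX: "b \<in> X" unfolding X_def using b nb sym by blast
    have CX: "C \<subseteq> X" unfolding C_def by (rule component_subset[OF bX])
    obtain f where f: "f \<in> F" "E t f" using T(4)[OF t] by blast
    obtain a g where ag: "a \<in> C" "g \<in> F" "g \<notin> C" "E a g"
    proof -
      have "b \<in> C" "f \<notin> C" using CX f(2) unfolding X_def C_def by auto
      then show ?thesis
        using connected_exit[OF F(1) b(1) f(1), of C] that by metis
    qed
    have tg: "E t g"
      using ag component_step[OF _ bX, of a E g] unfolding C_def X_def by blast
    have "E g t'" if t': "t' \<in> T" "E b t'" for t'
    proof (rule chordal_common_neighbours_adjacent[OF E, of C t])
      show "connected_set E C" unfolding C_def by (rule connected_component[OF E(1) bX])
      have "t \<noteq> t'" using t' nb by blast
      then show "E t t'" using T(1) t t' unfolding clique_def by blast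
      show "E t' b" using t'(2) by (rule sym)
      show "E g a" using ag(4) by (rule sym)
      show "b \<in> C" by (simp add: C_def)
      show "g \<noteq> t'" using ag(2) T(3) t'(1) by blast
      show "C \<subseteq> V" "t \<notin> C" "\<And>c. c \<in> C \<Longrightarrow> \<not> E t c"
        using CX X_def F(2) T(3) t by auto
    qed (use F(2) T(2) t t'(1) ag(1,2) tg in auto)
    then have "{t\<in>T. E b t} \<subset> {t\<in>T. E g t}"
      using t nb sym[OF tg] by blast
    then have "w b < w g"
      unfolding w_def using finT by (intro psubset_card_mono) auto
    then show False
      using b(2)[OF ag(2)] by simp
  qed
  then show ?thesis
    using that b(1) by blast
qed

section \<open>Minimal triangulations\<close>

text \<open>Vertices of \<open>X\<close> and \<open>Y\<close> are now separated by \<open>S\<close>.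
  For other pairs an old separating clique is trimmed. This needs a side of it that misses
  \<open>S\<close>; there is one, since a clique cannot meet both sides, and
  \<open>separated_sym\<close> allows to exchange them.\<close>

lemma chordal_delete_cross_edges:
  assumes sym: "symp H" and ch: "chordal V H" and S: "clique H S" "S \<subseteq> V"
    and X: "X \<subseteq> V" "Y \<subseteq> V" "X \<inter> S = {}" "Y \<inter> S = {}" "X \<inter> Y = {}" "V = X \<union> S \<union> Y"
  shows "chordal V (\<lambda>u v. H u v \<and> \<not> (u \<in> X \<and> v \<in> Y) \<and> \<not> (u \<in> Y \<and> v \<in> X))" (is "chordal V ?H")
proof -
  have symH: "\<And>x y. H x y \<Longrightarrow> H y x"
    using sym by (rule sympD)
  have sym': "symp ?H"
    using symH by (auto simp: symp_def)
  have S': "clique ?H S"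
    using S X unfolding clique_def by blast
  \<comment> \<open>A separating clique of \<open>H\<close> is trimmed to the side \<open>Q \<union> S\<close> on which both vertices lie.\<close>
  have trim: "separated V ?H u v"
    if A: "A \<subseteq> V" "T \<subseteq> V" "A \<inter> T = {}" "u \<in> A" "v \<in> V - A - T" "clique H T"
      "\<forall>x\<in>A. \<forall>y\<in>V - A - T. \<not> H x y"
      and SA: "S \<inter> A = {}" and Q: "Q = X \<and> R = Y \<or> Q = Y \<and> R = X" "u \<in> Q"
    for A T u v Q R
  proof (rule separatedI[of "A \<inter> Q" V "T \<inter> (Q \<union> S)"])
    show "clique ?H (T \<inter> (Q \<union> S))"
      using A(6) X(3-5) Q(1) unfolding clique_def by blast
    show "\<not> ?H x y" if "x \<in> A \<inter> Q" "y \<in> V" "y \<notin> A \<inter> Q" "y \<notin> T \<inter> (Q \<union> S)" for x y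
    proof
      assume h: "?H x y"
      then have "y \<notin> R"
        using Q(1) that(1) by blast
      then have "y \<in> Q \<union> S"
        using Q(1) that(2) X(6) by blast
      moreover have "y \<in> A \<union> T"
        using A(7) h that(1,2) by blast
      ultimately show False
        using that SA by blast
    qed
  qed (use A Q X S in auto)
  show ?thesis
    unfolding chordal_def
  proof (intro ballI impI)
    fix u v assume uv: "u \<in> V" "v \<in> V" "u \<noteq> v \<and> \<not> ?H u v"
    consider "u \<in> X \<and> v \<in> Y" | "u \<in> Y \<and> v \<in> X"
      | "\<not> H u v" "u \<in> X \<union> S \<and> v \<in> X \<union> S \<or> u \<in> Y \<union> S \<and> v \<in> Y \<union> S"
      using uv X(6) by blast
    then show "separated V ?H u v"
    proof cases
      case 1
      show ?thesis
        by (rule separatedI[of X V S]) (use 1 X S S' in auto)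
    next
      case 2
      show ?thesis
        by (rule separatedI[of Y V S]) (use 2 X S S' in auto)
    next
      case 3
      obtain A T where A: "A \<subseteq> V" "T \<subseteq> V" "A \<inter> T = {}" "u \<in> A" "v \<in> V - A - T" "clique H T"
        "\<forall>x\<in>A. \<forall>y\<in>V - A - T. \<not> H x y"
        using ch uv 3(1) unfolding chordal_def separated_def by meson
      show ?thesis
      proof (cases "S \<inter> A = {}")
        case True
        then have "u \<in> X \<or> u \<in> Y" using A X by blast
        then show ?thesis
          using trim[OF A True, of X Y] trim[OF A True, of Y X] by metis
      next
        case False
        let ?B = "V - A - T"
        have SB: "S \<inter> ?B = {}"
        proof (rule ccontr)
          assume "S \<inter> ?B \<noteq> {}"
          then obtain a b where "a \<in> S" "a \<in> A" "b \<in> S" "b \<in> ?B"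
            using False by blast
          moreover from this have "a \<noteq> b" by blast
          moreover from calculation have "H a b"
            using S(1) unfolding clique_def by blast
          ultimately show False
            using A(7) by blast
        qed
        then have "v \<in> X \<or> v \<in> Y" using A X by blast
        moreover have B: "?B \<subseteq> V" "T \<subseteq> V" "?B \<inter> T = {}" "v \<in> ?B" "u \<in> V - ?B - T" "clique H T"
          "\<forall>x\<in>?B. \<forall>y\<in>V - ?B - T. \<not> H x y"
          using A by (auto dest: symH)
        ultimately have "separated V ?H v u"
          using trim[OF B SB, of X Y] trim[OF B SB, of Y X] by metis
        then show ?thesis
          by (rule separated_sym[OF sym'])
      qed
    qed
  qed
qed

text \<open>All that is used of the minimality of a triangulation \<open>H\<close> of \<open>G\<close>.\<close>

definition min_fill :: "'a set \<Rightarrow> ('a \<Rightarrow> 'a \<Rightarrow> bool) \<Rightarrow> ('a \<Rightarrow> 'a \<Rightarrow> bool) \<Rightarrow> bool" where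
  "min_fill V G H \<longleftrightarrow> (\<forall>X S. X \<subseteq> V \<and> S \<subseteq> V \<and> X \<inter> S = {} \<and> clique H S \<and>
     (\<forall>x\<in>X. \<forall>y\<in>V - X - S. \<not> G x y) \<longrightarrow> (\<forall>x\<in>X. \<forall>y\<in>V - X - S. \<not> H x y))"

lemma min_fillD:
  assumes "min_fill V G H" "X \<subseteq> V" "S \<subseteq> V" "X \<inter> S = {}" "clique H S"
    "\<And>x y. x \<in> X \<Longrightarrow> y \<in> V \<Longrightarrow> y \<notin> X \<Longrightarrow> y \<notin> S \<Longrightarrow> \<not> G x y"
    "x \<in> X" "y \<in> V" "y \<notin> X" "y \<notin> S"
  shows "\<not> H x y"
  using assms(1)[unfolded min_fill_def, rule_format, of X S x y] assms(2-10) by auto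

text \<open>\<open>H\<close> has the fewest edges among the chordal graphs between \<open>G\<close>
  and \<open>J\<close>. If a clique \<open>S\<close> of \<open>H\<close> cut off \<open>X\<close> in
  \<open>G\<close> but not in \<open>H\<close>, deleting the cross edges would give a smaller
  chordal graph that still contains \<open>G\<close>.\<close>

lemma ex_minimal_triangulation:
  assumes fin: "finite V" and G: "symp G" "irreflp G" and J: "symp J" "irreflp J" "chordal V J"
    and GJ: "\<And>u v. G u v \<Longrightarrow> J u v"
  obtains H where "symp H" "irreflp H" "chordal V H" "min_fill V G H"
    "\<And>u v. G u v \<Longrightarrow> H u v" "\<And>u v. H u v \<Longrightarrow> J u v"
proof -
  define P where "P H \<longleftrightarrow> symp H \<and> chordal V H \<and> (\<forall>u v. G u v \<longrightarrow> H u v) \<and> (\<forall>u v. H u v \<longrightarrow> J u v)"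
    for H
  define w where "w H = card {(u, v). u \<in> V \<and> v \<in> V \<and> H u v}" for H :: "'a \<Rightarrow> 'a \<Rightarrow> bool"
  have "P J" unfolding P_def using J GJ by blast
  then obtain H where H: "P H" "\<And>H'. P H' \<Longrightarrow> w H \<le> w H'"
    using ex_has_least_nat[of P J w] by blast
  have H': "symp H" "chordal V H" "\<And>u v. G u v \<Longrightarrow> H u v" "\<And>u v. H u v \<Longrightarrow> J u v"
    using H(1) unfolding P_def by auto
  have "min_fill V G H"
    unfolding min_fill_def
  proof (intro allI impI ballI notI, elim conjE)
    fix X S x y
    assume X: "X \<subseteq> V" "S \<subseteq> V" "X \<inter> S = {}" "clique H S" "\<forall>x\<in>X. \<forall>y\<in>V - X - S. \<not> G x y"
      and xy: "x \<in> X" "y \<in> V - X - S" "H x y"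
    let ?Y = "V - X - S"
    let ?H = "\<lambda>u v. H u v \<and> \<not> (u \<in> X \<and> v \<in> ?Y) \<and> \<not> (u \<in> ?Y \<and> v \<in> X)"
    have "chordal V ?H"
      by (rule chordal_delete_cross_edges[OF H'(1,2) X(4)]) (use X in auto)
    moreover have "symp ?H"
      using H'(1) by (auto simp: symp_def)
    ultimately have "P ?H"
      unfolding P_def using H' X(5) sympD[OF G(1)] by blast
    then have "w H \<le> w ?H"
      by (rule H(2))
    moreover have "w ?H < w H"
      unfolding w_def
    proof (rule psubset_card_mono)
      show "finite {(u, v). u \<in> V \<and> v \<in> V \<and> H u v}"
        by (rule finite_subset[of _ "V \<times> V"]) (use fin in auto)
      have "(x, y) \<in> {(u, v). u \<in> V \<and> v \<in> V \<and> H u v} - {(u, v). u \<in> V \<and> v \<in> V \<and> ?H u v}"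
        using xy X by auto
      then show "{(u, v). u \<in> V \<and> v \<in> V \<and> ?H u v} \<subset> {(u, v). u \<in> V \<and> v \<in> V \<and> H u v}"
        by blast
    qed
    ultimately show False by simp
  qed
  moreover have "irreflp H"
    using J(2) H'(4) by (auto simp: irreflp_def)
  ultimately show ?thesis
    using that[of H] H' by blast
qed

text \<open>Let \<open>C\<close> be the \<open>G\<close>-component of \<open>x\<close> among the
  non-neighbours of \<open>z\<close> in \<open>H\<close>. The outer \<open>G\<close>-neighbours of
  \<open>C\<close> are \<open>H\<close>-neighbours of \<open>z\<close>, and they form a clique
  because they all touch the connected set \<open>D\<close>. By minimality \<open>H\<close> leaves
  \<open>C\<close> only into the neighbourhood of \<open>z\<close>, so a connection in
  \<open>H\<close> that avoids this neighbourhood stays in \<open>C\<close>.\<close>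

lemma min_fill_conn:
  assumes G: "symp G" and H: "symp H" "irreflp H" "chordal V H" "min_fill V G H" "\<And>u v. G u v \<Longrightarrow> H u v"
    and xyz: "x \<in> V" "z \<in> V" "x \<noteq> z" "\<not> H x z" "conn H {v\<in>V. \<not> H z v} x y"
  shows "conn G {v\<in>V. \<not> G z v} x y"
proof -
  have symG: "\<And>x y. G x y \<Longrightarrow> G y x" and symH: "\<And>x y. H x y \<Longrightarrow> H y x"
    using G H(1) by (auto dest: sympD)
  \<comment> \<open>By irreflexivity \<open>z\<close> is one of its own non-neighbours and has to be
    excluded explicitly.\<close>
  define W where "W = {v\<in>V. \<not> H z v \<and> v \<noteq> z}"
  define C where "C = component G W x"
  define D where "D = component H W x"
  define S where "S = {s\<in>V - C. \<exists>c\<in>C. G c s}"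
  have xW: "x \<in> W" unfolding W_def using xyz symH by blast
  have CW: "C \<subseteq> W" unfolding C_def by (rule component_subset[OF xW])
  have DW: "D \<subseteq> W" unfolding D_def by (rule component_subset[OF xW])
  have CD: "C \<subseteq> D" unfolding C_def D_def component_def using H(5) by (auto intro: conn_mono)
  have SN: "H z s" if sS: "s \<in> S" for s
  proof (rule ccontr)
    assume n: "\<not> H z s"
    obtain c where c: "c \<in> C" "G c s" "s \<in> V" "s \<notin> C"
      using sS unfolding S_def by blast
    have "s \<noteq> z" using c CW symH H(5) unfolding W_def by blast
    then have "s \<in> W" using c n unfolding W_def by blast
    then show False using c component_step[OF _ xW, of c G s] unfolding C_def by blast
  qed
  have cl: "clique H S"
    unfolding clique_def
  proof (intro ballI impI)
    fix s t assume st: "s \<in> S" "t \<in> S" "s \<noteq> t"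
    then obtain c d where cd: "c \<in> C" "G c s" "d \<in> C" "G d t"
      unfolding S_def by blast
    show "H s t"
    proof (rule chordal_common_neighbours_adjacent[OF H(1,3), of D z _ _ c d])
      show "connected_set H D" unfolding D_def by (rule connected_component[OF H(1) xW])
      show "H s c" "H t d" using cd by (auto intro: symH H(5))
      show "D \<subseteq> V" "z \<notin> D" "\<And>c. c \<in> D \<Longrightarrow> \<not> H z c"
        using DW unfolding W_def by auto
    qed (use st cd CD SN xyz(2) in \<open>auto simp: S_def\<close>)
  qed
  have noH: "\<not> H c v" if "c \<in> C" "v \<in> V" "v \<notin> C" "v \<notin> S" for c v
    by (rule min_fillD[OF H(4) _ _ _ cl, of C]) (use that CW in \<open>auto simp: W_def S_def\<close>)
  have "y \<in> C"
  proof (rule conn_closed[OF xyz(5)])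
    show "x \<in> C" unfolding C_def by simp
  next
    fix a b assume "a \<in> C" "b \<in> {v \<in> V. \<not> H z v}" "H a b"
    then show "b \<in> C" using noH SN by blast
  qed
  then show ?thesis
    unfolding C_def component_def W_def using H(5) by (auto intro: conn_subset)
qed

lemma min_fill_at_free:
  assumes "symp G" and H: "symp H" "irreflp H" "chordal V H" "min_fill V G H" "\<And>u v. G u v \<Longrightarrow> H u v"
    and "at_free V G"
  shows "at_free V H"
  unfolding at_free_def
proof (rule notI, elim bexE conjE)
  fix x y z
  assume a: "x \<in> V" "y \<in> V" "z \<in> V" "x \<noteq> y" "x \<noteq> z" "y \<noteq> z" "\<not> H x y" "\<not> H x z" "\<not> H y z"
    "conn H {v \<in> V. \<not> H z v} x y" "conn H {v \<in> V. \<not> H y v} x z" "conn H {v \<in> V. \<not> H x v} y z"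
  have "conn G {v\<in>V. \<not> G z v} x y" "conn G {v\<in>V. \<not> G y v} x z" "conn G {v\<in>V. \<not> G x v} y z"
    using min_fill_conn[OF assms(1) H, of x z y] min_fill_conn[OF assms(1) H, of x y z]
      min_fill_conn[OF assms(1) H, of y x z] a sympD[OF H(1)] by blast+
  then show False
    using assms(7) a H(5) unfolding at_free_def by blast
qed

section \<open>Interval representations\<close>

definition interval_rep :: "'a set \<Rightarrow> ('a \<Rightarrow> 'a \<Rightarrow> bool) \<Rightarrow> ('a \<Rightarrow> real) \<Rightarrow> ('a \<Rightarrow> real) \<Rightarrow> bool" where
  "interval_rep V E l r \<longleftrightarrow> (\<forall>v\<in>V. l v \<le> r v) \<and>
     (\<forall>u\<in>V. \<forall>v\<in>V. u \<noteq> v \<longrightarrow> (E u v \<longleftrightarrow> l u \<le> r v \<and> l v \<le> r u))"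

definition interval_graph :: "'a set \<Rightarrow> ('a \<Rightarrow> 'a \<Rightarrow> bool) \<Rightarrow> bool" where
  "interval_graph V E \<longleftrightarrow> (\<exists>l r. interval_rep V E l r)"

lemma interval_repI:
  assumes "\<And>v. v \<in> V \<Longrightarrow> l v \<le> r v"
    "\<And>u v. u \<in> V \<Longrightarrow> v \<in> V \<Longrightarrow> u \<noteq> v \<Longrightarrow> E u v \<longleftrightarrow> l u \<le> r v \<and> l v \<le> r u"
  shows "interval_rep V E l r"
  using assms unfolding interval_rep_def by blast

lemma interval_rep_le: "interval_rep V E l r \<Longrightarrow> v \<in> V \<Longrightarrow> l v \<le> r v"
  unfolding interval_rep_def by blast

lemma interval_rep_adj:
  "interval_rep V E l r \<Longrightarrow> u \<in> V \<Longrightarrow> v \<in> V \<Longrightarrow> u \<noteq> v \<Longrightarrow> E u v \<longleftrightarrow> l u \<le> r v \<and> l v \<le> r u"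
  unfolding interval_rep_def by blast

lemma interval_rep_mirror:
  "interval_rep V E l r \<Longrightarrow> interval_rep V E (\<lambda>v. - r v) (\<lambda>v. - l v)"
  unfolding interval_rep_def by auto

section \<open>Extending and gluing interval representations\<close>

lemma interval_rep_Un:
  assumes "symp E" "interval_rep A E l r" "interval_rep B E l r"
    "\<And>a b. a \<in> A - B \<Longrightarrow> b \<in> B - A \<Longrightarrow> E a b \<longleftrightarrow> l a \<le> r b \<and> l b \<le> r a"
  shows "interval_rep (A \<union> B) E l r"
proof (rule interval_repI)
  fix v assume "v \<in> A \<union> B"
  then show "l v \<le> r v"
    using assms(2,3) by (auto dest: interval_rep_le)
next
  fix u v assume uv: "u \<in> A \<union> B" "v \<in> A \<union> B" "u \<noteq> v"
  have sym: "E u v \<longleftrightarrow> E v u"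
    using assms(1) by (auto dest: sympD)
  consider "u \<in> A" "v \<in> A" | "u \<in> B" "v \<in> B" | "u \<in> A - B" "v \<in> B - A" | "v \<in> A - B" "u \<in> B - A"
    using uv by blast
  then show "E u v \<longleftrightarrow> l u \<le> r v \<and> l v \<le> r u"
  proof cases
    case 1
    then show ?thesis using interval_rep_adj[OF assms(2)] uv by blast
  next
    case 2
    then show ?thesis using interval_rep_adj[OF assms(3)] uv by blast
  next
    case 3
    then show ?thesis by (rule assms(4))
  next
    case 4
    then show ?thesis using assms(4)[OF 4] sym by blast
  qed
qed

text \<open>All of \<open>S\<close> is prolonged to a point \<open>B\<close> beyond every right end,
  and \<open>c\<close> becomes this point. Prolonging an interval that reaches \<open>q\<close>
  changes nothing for intervals ending before \<open>q\<close>, and the others were already its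
  neighbours. The last two conclusions prepare an insertion on the left.\<close>

lemma interval_rep_insert_right:
  assumes fin: "finite V" and sym: "symp E" and rep: "interval_rep V E l r"
    and c: "c \<notin> V" "S = {v\<in>V. E c v}" "clique E S"
    and q: "\<And>s. s \<in> S \<Longrightarrow> q \<le> r s"
      "\<And>v s. v \<in> V \<Longrightarrow> v \<notin> S \<Longrightarrow> q \<le> r v \<Longrightarrow> s \<in> S \<Longrightarrow> E v s"
  obtains l' r' where "interval_rep (insert c V) E l' r'" "\<And>v. v \<in> V \<Longrightarrow> l' v = l v" "q < l' c"
proof -
  have "finite (insert q (r ` V))" using fin by simp
  then obtain B where B: "\<And>v. v \<in> V \<Longrightarrow> r v < B" "q < B"
    by (metis Max_ge image_eqI insertI1 insertI2 gt_ex le_less_trans)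
  define l' where "l' = l(c := B)"
  define r' where "r' = (\<lambda>v. if v \<in> S \<or> v = c then B else r v)"
  have le: "\<And>v. v \<in> V \<Longrightarrow> l v \<le> r v" using rep by (rule interval_rep_le)
  have symE: "\<And>x y. E x y \<Longrightarrow> E y x" using sym by (rule sympD)
  have SV: "\<And>s. s \<in> S \<Longrightarrow> s \<in> V" using c(2) by blast
  have V: "interval_rep V E l' r'"
  proof (rule interval_repI)
    fix v assume "v \<in> V"
    then show "l' v \<le> r' v"
      using le[of v] B(1)[of v] c(1) by (auto simp: l'_def r'_def)
  next
    fix u v assume uv: "u \<in> V" "v \<in> V" "u \<noteq> v"
    have adj: "E u v \<longleftrightarrow> l u \<le> r v \<and> l v \<le> r u"
      using rep uv by (rule interval_rep_adj)
    have less: "l u < B" "l v < B" "u \<noteq> c" "v \<noteq> c"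
      using le[OF uv(1)] le[OF uv(2)] B(1)[OF uv(1)] B(1)[OF uv(2)] c(1) uv by auto
    show "E u v \<longleftrightarrow> l' u \<le> r' v \<and> l' v \<le> r' u"
    proof (cases "u \<in> S"; cases "v \<in> S")
      assume "u \<in> S" "v \<in> S"
      then have "E u v" using c(3) uv(3) unfolding clique_def by blast
      then show ?thesis using \<open>u \<in> S\<close> \<open>v \<in> S\<close> less by (simp add: l'_def r'_def)
    next
      assume s: "u \<in> S" "v \<notin> S"
      have "E u v" if "q \<le> r v"
        using q(2)[OF uv(2) s(2) that s(1)] by (rule symE)
      moreover have "l v \<le> r u" if "r v < q"
        using that le[OF uv(2)] q(1)[OF s(1)] by linarith
      ultimately have "E u v \<longleftrightarrow> l u \<le> r v"
        using adj by linarith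
      then show ?thesis using s less by (auto simp: l'_def r'_def)
    next
      assume s: "u \<notin> S" "v \<in> S"
      have "E u v" if "q \<le> r u"
        using q(2)[OF uv(1) s(1) that s(2)] .
      moreover have "l u \<le> r v" if "r u < q"
        using that le[OF uv(1)] q(1)[OF s(2)] by linarith
      ultimately have "E u v \<longleftrightarrow> l v \<le> r u"
        using adj by linarith
      then show ?thesis using s less by (auto simp: l'_def r'_def)
    next
      assume "u \<notin> S" "v \<notin> S"
      then show ?thesis using adj less by (simp add: l'_def r'_def)
    qed
  qed
  have "interval_rep (V \<union> {c}) E l' r'"
  proof (rule interval_rep_Un[OF sym V])
    show "interval_rep {c} E l' r'"
      by (rule interval_repI) (auto simp: l'_def r'_def)
  next
    fix a b assume ab: "a \<in> V - {c}" "b \<in> {c} - V"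
    have "E a c \<longleftrightarrow> a \<in> S" using c(2) symE ab by blast
    then show "E a b = (l' a \<le> r' b \<and> l' b \<le> r' a)"
      using ab le[of a] B(1)[of a] by (auto simp: l'_def r'_def)
  qed
  moreover have "l' v = l v" if "v \<in> V" for v
    using that c(1) by (auto simp: l'_def)
  moreover have "q < l' c"
    using B(2) by (simp add: l'_def)
  ultimately show ?thesis
    using that[of l' r'] by simp
qed

lemma interval_rep_insert_left:
  assumes "finite V" "symp E" "interval_rep V E l r"
    and "c \<notin> V" "S = {v\<in>V. E c v}" "clique E S"
    and "\<And>s. s \<in> S \<Longrightarrow> l s \<le> q"
      "\<And>v s. v \<in> V \<Longrightarrow> v \<notin> S \<Longrightarrow> l v \<le> q \<Longrightarrow> s \<in> S \<Longrightarrow> E v s"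
  shows "interval_graph (insert c V) E"
proof -
  obtain l' r' where "interval_rep (insert c V) E l' r'"
    by (rule interval_rep_insert_right[OF assms(1,2) interval_rep_mirror[OF assms(3)] assms(4,5,6), of "- q"])
      (use assms(7,8) in auto)
  then show ?thesis unfolding interval_graph_def by blast
qed

text \<open>Inserting \<open>c\<close> on the right moves no left end and puts \<open>c\<close>
  beyond \<open>q\<close>, hence beyond \<open>p\<close>; so the conditions for \<open>x\<close>,
  which concern left ends up to \<open>p\<close>, survive.\<close>

lemma interval_rep_insert_both:
  assumes fin: "finite V" and sym: "symp E" and rep: "interval_rep V E l r"
    and c: "c \<notin> V" "S = {v\<in>V. E c v}" "clique E S"
      "\<And>s. s \<in> S \<Longrightarrow> q \<le> r s"
      "\<And>v s. v \<in> V \<Longrightarrow> v \<notin> S \<Longrightarrow> q \<le> r v \<Longrightarrow> s \<in> S \<Longrightarrow> E v s"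
    and x: "x \<notin> V" "T = {v\<in>V. E x v}" "clique E T"
      "\<And>s. s \<in> T \<Longrightarrow> l s \<le> p"
      "\<And>v s. v \<in> V \<Longrightarrow> v \<notin> T \<Longrightarrow> l v \<le> p \<Longrightarrow> s \<in> T \<Longrightarrow> E v s"
    and "p \<le> q" "\<not> E x c" "x \<noteq> c"
  shows "interval_graph (insert x (insert c V)) E"
proof -
  obtain l' r' where r': "interval_rep (insert c V) E l' r'" "\<And>v. v \<in> V \<Longrightarrow> l' v = l v" "q < l' c"
    using interval_rep_insert_right[OF fin sym rep c] by blast
  show ?thesis
  proof (rule interval_rep_insert_left[OF _ sym r'(1), where S = T and q = p])
    show "T = {v \<in> insert c V. E x v}" using x(2) assms(15) by auto
    show "l' s \<le> p" if "s \<in> T" for s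
      using that x(2,4) r'(2) by auto
    show "E v s" if "v \<in> insert c V" "v \<notin> T" "l' v \<le> p" "s \<in> T" for v s
      using that r'(2,3) x(5)[of v s] \<open>p \<le> q\<close> by (cases "v = c") auto
  qed (use fin x assms(16) in auto)
qed

text \<open>\<open>b\<close> meets no vertex of the connected set \<open>F\<close>, so
  \<open>F\<close> lies on one side of \<open>b\<close>, after a reflection on the left. All of
  \<open>T\<close> reaches the point \<open>l b\<close>, where the picture is cut off and moved to
  0. The common right end of \<open>T\<close> is what makes two such pieces fit together.\<close>

lemma interval_rep_anchored:
  assumes sym: "symp E" and int: "interval_graph (insert b (F \<union> T)) E"
    and F: "connected_set E F" "b \<notin> F" "b \<notin> T" "F \<inter> T = {}" "\<And>f. f \<in> F \<Longrightarrow> \<not> E b f"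
    and T: "clique E T" "\<And>t. t \<in> T \<Longrightarrow> E b t"
  obtains l r where "interval_rep (F \<union> T) E l r" "\<And>f. f \<in> F \<Longrightarrow> r f < 0" "\<And>t. t \<in> T \<Longrightarrow> r t = 0"
proof -
  have left: "\<exists>l r. interval_rep (F \<union> T) E l r \<and> (\<forall>f\<in>F. r f < 0) \<and> (\<forall>t\<in>T. r t = 0)"
    if rep: "interval_rep (insert b (F \<union> T)) E l r" and lt: "\<And>f. f \<in> F \<Longrightarrow> r f < l b" for l r
  proof -
    \<comment> \<open>The minimum keeps the interval of \<open>v\<close> nonempty when
      \<open>v\<close> starts to the right of \<open>l b\<close>; such a \<open>v\<close> has no
      neighbour in \<open>F\<close>, and \<open>F\<close> misses the point 0 as well.\<close>
    define l' where "l' = (\<lambda>v. if v \<in> T then min (l v - l b) 0 else l v - l b)"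
    define r' where "r' = (\<lambda>v. if v \<in> T then 0 else r v - l b)"
    have le: "l v \<le> r v" if "v \<in> F \<union> T" for v
      using interval_rep_le[OF rep] that by blast
    have FT: "f \<notin> T" if "f \<in> F" for f
      using F(4) that by blast
    have tb: "l b \<le> r t" if "t \<in> T" for t
      using interval_rep_adj[OF rep, of b t] T(2)[OF that] that F(3) by auto
    have "interval_rep (F \<union> T) E l' r'"
    proof (rule interval_rep_Un[OF sym])
      show "interval_rep F E l' r'"
        using rep FT unfolding interval_rep_def by (simp add: l'_def r'_def)
      show "interval_rep T E l' r'"
        using T(1) unfolding interval_rep_def clique_def by (simp add: l'_def r'_def)
      fix f t assume ft: "f \<in> F - T" "t \<in> T - F"
      have "E f t \<longleftrightarrow> l f \<le> r t \<and> l t \<le> r f"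
        using rep by (rule interval_rep_adj) (use ft in auto)
      moreover have "l f \<le> r t" "l f < l b"
        using le[of f] lt[of f] tb[of t] ft by auto
      ultimately show "E f t = (l' f \<le> r' t \<and> l' t \<le> r' f)"
        using ft lt[of f] by (auto simp: l'_def r'_def)
    qed
    moreover have "\<forall>f\<in>F. r' f < 0" "\<forall>t\<in>T. r' t = 0"
      using lt FT by (auto simp: r'_def)
    ultimately show ?thesis by blast
  qed
  obtain l r where rep: "interval_rep (insert b (F \<union> T)) E l r"
    using int unfolding interval_graph_def by blast
  have side: "r f < l b \<or> r b < l f" if "f \<in> F" for f
    using interval_rep_adj[OF rep, of b f] F(2,5)[of] that by (metis UnI1 insertCI not_le)
  have "(\<forall>f\<in>F. r f < l b) \<or> (\<forall>f\<in>F. r b < l f)"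
  proof (rule ccontr)
    assume "\<not> ?thesis"
    then obtain f g where fg: "f \<in> F" "g \<in> F" "r f < l b" "\<not> r g < l b"
      using side by blast
    then obtain x y where xy: "r x < l b" "x \<in> F" "y \<in> F" "\<not> r y < l b" "E x y"
      using connected_exit[OF F(1) fg(1,2), of "{v. r v < l b}"] by auto
    have "x \<noteq> y" using xy by blast
    then have "l y \<le> r x" using interval_rep_adj[OF rep, of x y] xy by blast
    moreover have "r b < l y" using side[OF xy(3)] xy(4) by blast
    moreover have "l b \<le> r b" using interval_rep_le[OF rep] by blast
    ultimately show False using xy(1) by linarith
  qed
  then have "\<exists>l r. interval_rep (F \<union> T) E l r \<and> (\<forall>f\<in>F. r f < 0) \<and> (\<forall>t\<in>T. r t = 0)"
    using left[OF rep] left[OF interval_rep_mirror[OF rep]] by force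
  then show ?thesis using that by blast
qed

text \<open>\<open>F1\<close> goes to the left of 0, the reflected \<open>F2\<close> to the right of
  \<open>N\<close>, and \<open>Z\<close> between them. A vertex of \<open>T\<close> takes its left
  end from the piece of \<open>F1\<close> and its right end from the piece of \<open>F2\<close>, so
  it covers \<open>Z\<close>. In each piece the other side is represented only by its vertex
  \<open>b1\<close> or \<open>b2\<close> complete to \<open>T\<close>, which is the anchor.\<close>

lemma interval_rep_assemble:
  assumes sym: "symp E" and T: "clique E T" and fin: "finite Z"
    and disj: "F1 \<inter> T = {}" "F2 \<inter> T = {}" "Z \<inter> T = {}" "F1 \<inter> F2 = {}" "F1 \<inter> Z = {}" "F2 \<inter> Z = {}"
    and nadj: "\<And>x y. x \<in> F1 \<Longrightarrow> y \<in> F2 \<Longrightarrow> \<not> E x y" "\<And>x y. x \<in> F1 \<Longrightarrow> y \<in> Z \<Longrightarrow> \<not> E x y"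
      "\<And>x y. x \<in> F2 \<Longrightarrow> y \<in> Z \<Longrightarrow> \<not> E x y"
    and Z: "\<And>z t. z \<in> Z \<Longrightarrow> t \<in> T \<Longrightarrow> E z t" "interval_graph Z E"
    and F1: "connected_set E F1" "interval_graph (insert b2 (F1 \<union> T)) E"
      "b1 \<in> F1" "\<And>t. t \<in> T \<Longrightarrow> E b1 t"
    and F2: "connected_set E F2" "interval_graph (insert b1 (F2 \<union> T)) E"
      "b2 \<in> F2" "\<And>t. t \<in> T \<Longrightarrow> E b2 t"
  obtains l r N where "interval_rep (F1 \<union> F2 \<union> Z \<union> T) E l r" "0 < N"
    "\<forall>f\<in>F1. r f < 0" "\<forall>f\<in>F2. N < l f" "\<forall>z\<in>Z. 0 < l z \<and> r z < N"
    "\<forall>t\<in>T. l t \<le> 0 \<and> N \<le> r t"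
proof -
  have symE: "\<And>x y. E x y \<Longrightarrow> E y x" using sym by (rule sympD)
  obtain l1 r1 where r1: "interval_rep (F1 \<union> T) E l1 r1" "\<And>f. f \<in> F1 \<Longrightarrow> r1 f < 0" "\<And>t. t \<in> T \<Longrightarrow> r1 t = 0"
  proof (rule interval_rep_anchored[OF sym F1(2) F1(1)])
    show "\<not> E b2 f" if "f \<in> F1" for f
      using nadj(1)[OF that F2(3)] symE by blast
  qed (use disj F2(3,4) T in blast)+
  obtain l2 r2 where r2: "interval_rep (F2 \<union> T) E l2 r2" "\<And>f. f \<in> F2 \<Longrightarrow> r2 f < 0" "\<And>t. t \<in> T \<Longrightarrow> r2 t = 0"
  proof (rule interval_rep_anchored[OF sym F2(2) F2(1)])
    show "\<not> E b1 f" if "f \<in> F2" for f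
      using nadj(1)[OF F1(3) that] .
  qed (use disj F1(3,4) T in blast)+
  obtain lz rz where rz: "interval_rep Z E lz rz"
    using Z(2) unfolding interval_graph_def by blast
  obtain B where B: "B \<ge> 0" "\<And>z. z \<in> Z \<Longrightarrow> \<bar>lz z\<bar> \<le> B" "\<And>z. z \<in> Z \<Longrightarrow> \<bar>rz z\<bar> \<le> B"
  proof
    let ?B = "\<Sum>z\<in>Z. \<bar>lz z\<bar> + \<bar>rz z\<bar>"
    show "?B \<ge> 0" by (intro sum_nonneg) auto
    have "\<bar>lz z\<bar> + \<bar>rz z\<bar> \<le> ?B" if "z \<in> Z" for z
      using that fin by (intro member_le_sum) auto
    then show "\<bar>lz z\<bar> \<le> ?B" "\<bar>rz z\<bar> \<le> ?B" if "z \<in> Z" for z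
      using that by (smt (verit) abs_ge_zero)+
  qed
  \<comment> \<open>The representation of \<open>Z\<close> lies in \<open>[-B, B]\<close>; shifted
    by \<open>B + 1\<close> it lies strictly between 0 and \<open>N\<close>.\<close>
  define N where "N = 2 * B + 2"
  define l where "l = (\<lambda>v. if v \<in> F2 then N - r2 v else if v \<in> Z then lz v + B + 1 else l1 v)"
  define r where "r = (\<lambda>v. if v \<in> F1 then r1 v else if v \<in> Z then rz v + B + 1 else N - l2 v)"
  have l_simps: "v \<in> F1 \<Longrightarrow> l v = l1 v" "v \<in> F2 \<Longrightarrow> l v = N - r2 v" "v \<in> Z \<Longrightarrow> l v = lz v + B + 1"
    "v \<in> T \<Longrightarrow> l v = l1 v" for v
    using disj by (auto simp: l_def)
  have r_simps: "v \<in> F1 \<Longrightarrow> r v = r1 v" "v \<in> F2 \<Longrightarrow> r v = N - l2 v" "v \<in> Z \<Longrightarrow> r v = rz v + B + 1"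
    "v \<in> T \<Longrightarrow> r v = N - l2 v" for v
    using disj by (auto simp: r_def)
  have N0: "0 < N" using B(1) by (simp add: N_def)
  have T0: "l1 t \<le> 0" "l2 t \<le> 0" if "t \<in> T" for t
    using interval_rep_le[OF r1(1), of t] interval_rep_le[OF r2(1), of t] r1(3) r2(3) that by auto
  have F1le: "l1 f \<le> r1 f" "r1 f < 0" if "f \<in> F1" for f
    using interval_rep_le[OF r1(1), of f] r1(2) that by auto
  have F2le: "l2 f \<le> r2 f" "r2 f < 0" if "f \<in> F2" for f
    using interval_rep_le[OF r2(1), of f] r2(2) that by auto
  have Zle: "0 < l z" "l z \<le> r z" "r z < N" if "z \<in> Z" for z
    using B(2,3)[OF that] interval_rep_le[OF rz that] that by (auto simp: l_simps r_simps N_def)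
  have repT: "interval_rep T E l r"
  proof (rule interval_repI)
    fix v assume "v \<in> T"
    then show "l v \<le> r v" using T0[of v] N0 by (simp add: l_simps r_simps)
  next
    fix u v assume "u \<in> T" "v \<in> T" "u \<noteq> v"
    then show "E u v = (l u \<le> r v \<and> l v \<le> r u)"
      using T0[of u] T0[of v] N0 T unfolding clique_def by (auto simp: l_simps r_simps)
  qed
  have repF1: "interval_rep (F1 \<union> T) E l r"
  proof (rule interval_rep_Un[OF sym _ repT])
    show "interval_rep F1 E l r"
      using r1(1) unfolding interval_rep_def by (auto simp: l_simps r_simps)
    fix f t assume ft: "f \<in> F1 - T" "t \<in> T - F1"
    then have "E f t \<longleftrightarrow> l1 f \<le> r1 t \<and> l1 t \<le> r1 f"
      by (intro interval_rep_adj[OF r1(1)]) auto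
    then show "E f t = (l f \<le> r t \<and> l t \<le> r f)"
      using ft F1le[of f] T0[of t] r1(3)[of t] N0 by (auto simp: l_simps r_simps)
  qed
  have repF2: "interval_rep F2 E l r"
    using r2(1) unfolding interval_rep_def by (auto simp: l_simps r_simps)
  have repZ: "interval_rep Z E l r"
    using rz unfolding interval_rep_def by (auto simp: l_simps r_simps)
  have "interval_rep (F2 \<union> Z) E l r"
  proof (rule interval_rep_Un[OF sym repF2 repZ])
    fix f z assume "f \<in> F2 - Z" "z \<in> Z - F2"
    then show "E f z = (l f \<le> r z \<and> l z \<le> r f)"
      using nadj(3)[of f z] Zle[of z] F2le[of f] l_simps(2)[of f] by auto
  qed
  with repF1 have "interval_rep ((F1 \<union> T) \<union> (F2 \<union> Z)) E l r"
  proof (rule interval_rep_Un[OF sym])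
    fix a b assume ab: "a \<in> F1 \<union> T - (F2 \<union> Z)" "b \<in> F2 \<union> Z - (F1 \<union> T)"
    consider "a \<in> F1" "b \<in> F2" | "a \<in> F1" "b \<in> Z" | "a \<in> T" "b \<in> F2" | "a \<in> T" "b \<in> Z"
      using ab by blast
    then show "E a b = (l a \<le> r b \<and> l b \<le> r a)"
    proof cases
      case 1
      then show ?thesis
        using nadj(1)[OF 1] F1le[of a] F2le[of b] N0 by (auto simp: l_simps r_simps)
    next
      case 2
      then show ?thesis
        using nadj(2)[OF 2] F1le[of a] Zle[of b] r_simps(1)[of a] by auto
    next
      case 3
      then have "E b a \<longleftrightarrow> l2 b \<le> r2 a \<and> l2 a \<le> r2 b"
        using disj by (intro interval_rep_adj[OF r2(1)]) auto
      then show ?thesis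
        using 3 symE T0[of a] F2le[of b] r2(3)[of a] N0 by (auto simp: l_simps r_simps)
    next
      case 4
      then show ?thesis
        using symE[OF Z(1)[OF 4(2,1)]] T0[of a] Zle[of b] l_simps(4)[of a] r_simps(4)[of a] by auto
    qed
  qed
  moreover have "(F1 \<union> T) \<union> (F2 \<union> Z) = F1 \<union> F2 \<union> Z \<union> T" by blast
  ultimately have rep: "interval_rep (F1 \<union> F2 \<union> Z \<union> T) E l r" by simp
  show ?thesis
  proof (rule that[OF rep N0])
  qed (use F1le F2le Zle T0 in \<open>auto simp: l_simps r_simps\<close>)
qed

section \<open>Chordal AT-free graphs are interval graphs\<close>

lemma connected_bridge:
  assumes "symp E" "connected_set E A" "connected_set E B" "a \<in> A" "E t a" "b \<in> B" "E t b"
  shows "connected_set E (insert t (A \<union> B))"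
  using connected_union[OF assms(1) connected_insert[OF assms(1,2,4,5)] assms(3), of t b] assms
  by simp

lemma components_nonadjacent:
  assumes "a \<in> component E X x" "b \<in> component E X y" "component E X x \<noteq> component E X y"
    "symp E" "x \<in> X" "y \<in> X"
  shows "a \<noteq> b" "\<not> E a b"
proof -
  have eq: "component E X a = component E X x" "component E X b = component E X y"
    using component_eqI assms by metis+
  then show "a \<noteq> b" using assms(3) by blast
  show "\<not> E a b"
  proof
    assume "E a b"
    moreover have "b \<in> X" using component_subset[OF assms(6), of E] assms(2) by blast
    ultimately have "b \<in> component E X x"
      by (rule component_step[OF assms(1,5)])
    then have "component E X b = component E X x"
      by (rule component_eqI[OF assms(4)])
    then show False
      using eq assms(3) by simp
  qed
qed

text \<open>\<open>z1\<close>, \<open>z2\<close>, \<open>z3\<close> would be an asteroidal triple: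
  the components of two of them are joined through the vertex of \<open>T\<close> that the third one
  misses.\<close>

lemma three_incomplete_components:
  assumes sym: "symp E" and at: "at_free W E" and T: "T \<subseteq> W"
    and full: "\<And>x t. x \<in> W - T \<Longrightarrow> t \<in> T \<Longrightarrow> \<exists>y\<in>component E (W - T) x. E t y"
    and z: "z1 \<in> W - T" "z2 \<in> W - T" "z3 \<in> W - T"
    and ne: "component E (W - T) z1 \<noteq> component E (W - T) z2"
      "component E (W - T) z1 \<noteq> component E (W - T) z3"
      "component E (W - T) z2 \<noteq> component E (W - T) z3"
    and t: "t1 \<in> T" "\<not> E z1 t1" "t2 \<in> T" "\<not> E z2 t2" "t3 \<in> T" "\<not> E z3 t3"
  shows False
proof -
  let ?K = "component E (W - T)"
  have con: "connected_set E (?K z)" if "z \<in> W - T" for z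
    using that by (rule connected_component[OF sym])
  have sub: "?K z \<subseteq> W - T" if "z \<in> W - T" for z
    using that by (rule component_subset)
  have bridge: "connected_set E (insert s (?K x \<union> ?K y))" if "x \<in> W - T" "y \<in> W - T" "s \<in> T" for x y s
    using full[OF that(1,3)] full[OF that(2,3)] connected_bridge[OF sym con[OF that(1)] con[OF that(2)]]
    by blast
  have nadj: "\<not> E z p" if "x \<in> W - T" "z \<in> W - T" "?K z \<noteq> ?K x" "p \<in> ?K x" for x z p
    using components_nonadjacent(2)[OF component_self that(4,3) sym that(2,1)] .
  have dist: "z1 \<noteq> z2" "z1 \<noteq> z3" "z2 \<noteq> z3" using ne by auto
  show False
  proof (rule at_freeD[OF at _ _ _ dist])
    show "connected_set E (insert t3 (?K z1 \<union> ?K z2))" using bridge z t by blast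
    show "connected_set E (insert t2 (?K z1 \<union> ?K z3))" using bridge z t by blast
    show "connected_set E (insert t1 (?K z2 \<union> ?K z3))" using bridge z t by blast
    show "\<not> E z1 z2" "\<not> E z1 z3" "\<not> E z2 z3"
      using nadj[of z2 z1 z2] nadj[of z3 z1 z3] nadj[of z3 z2 z3] z ne by auto
    show "insert t3 (?K z1 \<union> ?K z2) \<subseteq> W" "insert t2 (?K z1 \<union> ?K z3) \<subseteq> W"
      "insert t1 (?K z2 \<union> ?K z3) \<subseteq> W"
      using sub z t T by blast+
    show "\<not> E z3 p" if "p \<in> insert t3 (?K z1 \<union> ?K z2)" for p
      using that nadj[of z1 z3 p] nadj[of z2 z3 p] z ne t by auto
    show "\<not> E z2 p" if "p \<in> insert t2 (?K z1 \<union> ?K z3)" for p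
      using that nadj[of z1 z2 p] nadj[of z3 z2 p] z ne t by auto
    show "\<not> E z1 p" if "p \<in> insert t1 (?K z2 \<union> ?K z3)" for p
      using that nadj[of z2 z1 p] nadj[of z3 z1 p] z ne t by auto
  qed (use z in auto)
qed

text \<open>By the previous lemma, at most two components of \<open>W - T\<close> are not complete to \<open>T\<close>;
  they are \<open>F1\<close> and \<open>F2\<close>.\<close>

lemma split_at_full_separator:
  assumes sym: "symp E" and at: "at_free W E" and ch: "chordal W E" and fin: "finite W"
    and T: "T \<subseteq> W" "clique E T"
    and full: "\<And>x t. x \<in> W - T \<Longrightarrow> t \<in> T \<Longrightarrow> \<exists>y\<in>component E (W - T) x. E t y"
    and xy: "x0 \<in> W - T" "y0 \<in> W - T" "component E (W - T) x0 \<noteq> component E (W - T) y0"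
  obtains F1 F2 Z b1 b2 where
    "W = F1 \<union> F2 \<union> Z \<union> T" "F1 \<inter> T = {}" "F2 \<inter> T = {}" "Z \<inter> T = {}" "F1 \<inter> F2 = {}" "F1 \<inter> Z = {}"
    "F2 \<inter> Z = {}" "\<forall>x\<in>F1. \<forall>y\<in>F2. \<not> E x y" "\<forall>x\<in>F1. \<forall>y\<in>Z. \<not> E x y"
    "\<forall>x\<in>F2. \<forall>y\<in>Z. \<not> E x y" "\<forall>z\<in>Z. \<forall>t\<in>T. E z t"
    "connected_set E F1" "connected_set E F2" "b1 \<in> F1" "\<forall>t\<in>T. E b1 t"
    "b2 \<in> F2" "\<forall>t\<in>T. E b2 t"
proof -
  let ?K = "component E (W - T)"
  define bad where "bad z \<longleftrightarrow> z \<in> W - T \<and> (\<exists>t\<in>T. \<not> E z t)" for z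
  have three: "?K z1 = ?K z2 \<or> ?K z1 = ?K z3 \<or> ?K z2 = ?K z3" if "bad z1" "bad z2" "bad z3" for z1 z2 z3
    using three_incomplete_components[OF sym at T(1) full, of z1 z2 z3] that unfolding bad_def by blast
  \<comment> \<open>If fewer than two components are incomplete, \<open>x0\<close> or
    \<open>y0\<close> supplies the missing ones, so that both outer pieces exist in every
    case.\<close>
  have "\<exists>a b. a \<in> W - T \<and> b \<in> W - T \<and> ?K a \<noteq> ?K b \<and> (\<forall>z. bad z \<longrightarrow> z \<in> ?K a \<or> z \<in> ?K b)"
  proof (cases "\<exists>a. bad a")
    case False
    then show ?thesis using xy by blast
  next
    case True
    then obtain a where a: "bad a" by blast
    show ?thesis
    proof (cases "\<exists>b. bad b \<and> ?K a \<noteq> ?K b")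
      case True
      then obtain b where b: "bad b" "?K a \<noteq> ?K b" by blast
      have "z \<in> ?K a \<or> z \<in> ?K b" if "bad z" for z
        using three[OF a b(1) that] b(2) by (metis component_self)
      then show ?thesis using a b unfolding bad_def by blast
    next
      case False
      then have 1: "z \<in> ?K a" if "bad z" for z
        using that by (metis component_self)
      have "a \<in> W - T" using a unfolding bad_def by blast
      then show ?thesis
        using 1 xy by (cases "?K a = ?K x0") metis+
    qed
  qed
  then obtain a b where ab: "a \<in> W - T" "b \<in> W - T" "?K a \<noteq> ?K b" "\<And>z. bad z \<Longrightarrow> z \<in> ?K a \<or> z \<in> ?K b"
    by blast
  have sub: "?K a \<subseteq> W - T" "?K b \<subseteq> W - T"
    using component_subset[OF ab(1)] component_subset[OF ab(2)] by auto
  have con: "connected_set E (?K a)" "connected_set E (?K b)"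
    using connected_component[OF sym ab(1)] connected_component[OF sym ab(2)] by auto
  have ne: "?K a \<noteq> {}" "?K b \<noteq> {}"
    using component_self by (metis empty_iff)+
  define Z where "Z = W - T - ?K a - ?K b"
  obtain b1 where b1: "b1 \<in> ?K a" "\<And>t. t \<in> T \<Longrightarrow> E b1 t"
    by (rule ex_complete_vertex[OF sym ch fin con(1) _ _ T(2,1)])
      (use sub full[OF ab(1)] ne in auto)
  obtain b2 where b2: "b2 \<in> ?K b" "\<And>t. t \<in> T \<Longrightarrow> E b2 t"
    by (rule ex_complete_vertex[OF sym ch fin con(2) _ _ T(2,1)])
      (use sub full[OF ab(2)] ne in auto)
  show ?thesis
  proof (rule that[of "?K a" "?K b" Z b1 b2])
    show "?K a \<inter> ?K b = {}"
      using components_nonadjacent(1)[OF _ _ ab(3) sym ab(1,2)] by blast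
    show "\<forall>x\<in>?K a. \<forall>y\<in>?K b. \<not> E x y"
      using components_nonadjacent(2)[OF _ _ ab(3) sym ab(1,2)] by blast
    show "\<forall>x\<in>?K a. \<forall>y\<in>Z. \<not> E x y"
      using component_step[OF _ ab(1)] unfolding Z_def by blast
    show "\<forall>x\<in>?K b. \<forall>y\<in>Z. \<not> E x y"
      using component_step[OF _ ab(2)] unfolding Z_def by blast
    show "\<forall>z\<in>Z. \<forall>t\<in>T. E z t"
      using ab(4) unfolding Z_def bad_def by blast
  qed (use sub T con b1 b2 Z_def in auto)
qed

text \<open>For an irreflexive \<open>E\<close>, the neighbourhood of \<open>c\<close> is a clique
  separator that leaves just two components, \<open>{c}\<close> and the rest, and each of its
  vertices has neighbours in both. Gluing here makes no progress, since the rest with its separator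
  and the anchor \<open>c\<close> is all of \<open>V\<close>.\<close>

definition end_vertex :: "'a set \<Rightarrow> ('a \<Rightarrow> 'a \<Rightarrow> bool) \<Rightarrow> 'a \<Rightarrow> bool" where
  "end_vertex V E c \<longleftrightarrow> c \<in> V \<and> clique E {v\<in>V. E c v} \<and>
     {v\<in>V. v \<noteq> c \<and> \<not> E c v} \<noteq> {} \<and> connected_set E {v\<in>V. v \<noteq> c \<and> \<not> E c v} \<and>
     (\<forall>n\<in>V. E c n \<longrightarrow> (\<exists>w\<in>V. w \<noteq> c \<and> \<not> E c w \<and> E n w))"

text \<open>A neighbour \<open>x\<close> of \<open>c\<close> would have a neighbour \<open>w\<close>
  not adjacent to \<open>c\<close>, although \<open>c\<close> and \<open>w\<close> both lie in the
  clique of neighbours of \<open>x\<close>.\<close>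

lemma end_vertices_nonadjacent:
  assumes "symp E" "end_vertex V E c" "end_vertex V E x" "c \<noteq> x"
  shows "\<not> E c x"
proof
  assume cx: "E c x"
  then obtain w where w: "w \<in> V" "w \<noteq> c" "\<not> E c w" "E x w"
    using assms(2,3) unfolding end_vertex_def by blast
  have "E x c" "c \<in> V" using sympD[OF assms(1) cx] assms(2) unfolding end_vertex_def by auto
  then have "c \<in> {v\<in>V. E x v}" "w \<in> {v\<in>V. E x v}" using w by auto
  moreover have "clique E {v\<in>V. E x v}" using assms(3) unfolding end_vertex_def by blast
  ultimately have "E c w" using w(2) unfolding clique_def by metis
  then show False using w by blast
qed

text \<open>The non-neighbours of each of the three form a connected set that contains the other
  two, which makes an asteroidal triple.\<close>

lemma three_end_vertices:
  assumes sym: "symp E" and at: "at_free V E"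
    and e: "end_vertex V E x" "end_vertex V E y" "end_vertex V E z" and d: "x \<noteq> y" "x \<noteq> z" "y \<noteq> z"
  shows False
proof -
  have V: "x \<in> V" "y \<in> V" "z \<in> V" using e unfolding end_vertex_def by auto
  have n: "\<not> E x y" "\<not> E x z" "\<not> E y z" "\<not> E y x" "\<not> E z x" "\<not> E z y"
    using end_vertices_nonadjacent[OF sym] e d by metis+
  have con: "connected_set E {v\<in>V. v \<noteq> c \<and> \<not> E c v}" if "end_vertex V E c" for c
    using that unfolding end_vertex_def by blast
  show False
    by (rule at_freeD[OF at V d n(1,2,3) con[OF e(3)] _ _ _ _ con[OF e(2)] _ _ _ _ con[OF e(1)]])
      (use V d n in auto)
qed

lemma card_le_two_cases:
  assumes "\<And>x y z. x \<in> A \<Longrightarrow> y \<in> A \<Longrightarrow> z \<in> A \<Longrightarrow> x \<noteq> y \<Longrightarrow> x \<noteq> z \<Longrightarrow> y \<noteq> z \<Longrightarrow> False"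
  obtains "A = {}" | c where "A = {c}" | c x where "c \<noteq> x" "A = {c, x}"
proof (cases "A = {}")
  case False
  then obtain c where c: "c \<in> A" by blast
  show ?thesis
  proof (cases "A = {c}")
    case False
    then obtain x where x: "x \<in> A" "x \<noteq> c" using c by blast
    then have "A = {c, x}" using assms c by blast
    then show ?thesis using that(3) x(2) by blast
  qed (use that in blast)
qed (use that in blast)

text \<open>\<open>c\<close>, \<open>x\<close>, \<open>f\<close> would be an asteroidal triple:
  \<open>c\<close> and \<open>x\<close> are joined through \<open>s\<close> and \<open>s'\<close>,
  which \<open>f\<close> misses; \<open>c\<close> reaches \<open>F\<close> through a neighbour
  \<open>u\<close> that \<open>x\<close> misses, and \<open>x\<close> through a \<open>u'\<close>
  that \<open>c\<close> misses. This is what allows two end vertices to be placed on different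
  sides.\<close>

lemma two_ends_same_side:
  assumes sym: "symp E" and at: "at_free V E"
    and e: "end_vertex V E c" "end_vertex V E x" "c \<noteq> x"
    and F: "connected_set E F" "F \<subseteq> V" "F \<inter> T = {}" "\<And>t. t \<in> T \<Longrightarrow> \<exists>f\<in>F. E t f" "c \<notin> F" "x \<notin> F"
    and T: "clique E T" "T \<subseteq> V" "\<And>v. v \<in> V \<Longrightarrow> E c v \<Longrightarrow> v \<in> T" "\<And>v. v \<in> V \<Longrightarrow> E x v \<Longrightarrow> v \<in> T"
    and f: "f \<in> F" "s \<in> V" "E c s" "\<not> E f s" "s' \<in> V" "E x s'" "\<not> E f s'"
  shows False
proof -
  have symE: "\<And>x y. E x y \<Longrightarrow> E y x" using sym by (rule sympD)
  have cx: "\<not> E c x" "\<not> E x c"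
    using end_vertices_nonadjacent[OF sym e] symE by blast+
  have cF: "\<not> E c g" "\<not> E x g" "g \<in> V" if "g \<in> F" for g
    using that T(3,4) F(2,3) by blast+
  have V: "c \<in> V" "x \<in> V" using e unfolding end_vertex_def by auto
  \<comment> \<open>The non-neighbours of the end vertex \<open>b\<close> are connected and contain
    \<open>a\<close> and \<open>f\<close>, so \<open>a\<close> has a neighbour among them.\<close>
  have own: "\<exists>s\<in>V. E a s \<and> \<not> E b s"
    if ab: "end_vertex V E b" "a \<in> V" "a \<noteq> b" "\<not> E b a" "f \<noteq> a" "f \<noteq> b" "\<not> E b f" for a b
  proof -
    let ?U = "{v\<in>V. v \<noteq> b \<and> \<not> E b v}"
    have "connected_set E ?U" using ab(1) unfolding end_vertex_def by blast
    moreover have "a \<in> ?U" "f \<in> ?U" using ab f(1) F(2) by auto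
    ultimately show ?thesis
      by (rule connected_exit[where A = "{a}"]) (use ab(5) in auto)
  qed
  obtain u where u: "u \<in> V" "E c u" "\<not> E x u"
    using own[OF e(2) V(1) e(3) cx(2)] f(1) F(5,6) cF(2)[OF f(1)] by blast
  obtain u' where u': "u' \<in> V" "E x u'" "\<not> E c u'"
    using own[OF e(1) V(2) e(3)[symmetric] cx(1)] f(1) F(5,6) cF(1)[OF f(1)] by blast
  have conF: "connected_set E (insert a (insert v F))" if "E a v" "v \<in> T" for a v
  proof -
    obtain g where "g \<in> F" "E v g" using F(4)[OF \<open>v \<in> T\<close>] by blast
    then have "connected_set E (insert v F)" using connected_insert[OF sym F(1)] by blast
    then show ?thesis using connected_insert[OF sym, of "insert v F" v a] that by blast
  qed
  have "connected_set E ({c, s} \<union> {x, s'})"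
  proof (rule connected_union[OF sym])
    show "connected_set E {c, s}" using connected_insert[OF sym connected_singleton, of s s c] f by simp
    show "connected_set E {x, s'}" using connected_insert[OF sym connected_singleton, of s' s' x] f by simp
    show "s = s' \<or> E s s'" using T(1,3,4) f unfolding clique_def by blast
  qed auto
  then have con: "connected_set E {c, s, x, s'}" by (simp add: insert_commute)
  have nf: "\<not> E f c" "\<not> E f x" using cF[OF f(1)] symE by blast+
  show False
  proof (rule at_freeD[OF at V cF(3)[OF f(1)] e(3) _ _ cx(1) _ _ con])
    show "connected_set E (insert c (insert u F))" "connected_set E (insert x (insert u' F))"
      using conF u u' T(3,4) by blast+
    show "c \<noteq> f" "x \<noteq> f" using f F(5,6) by auto
    show "\<not> E c f" "\<not> E x f" using cF[OF f(1)] by auto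
    show "\<not> E f p" if "p \<in> {c, s, x, s'}" for p
      using that nf f by auto
    show "\<not> E x p" if "p \<in> insert c (insert u F)" for p
      using that cx u cF by auto
    show "\<not> E c p" if "p \<in> insert x (insert u' F)" for p
      using that cx u' cF by auto
  qed (use f V F(2) u u' in auto)
qed

text \<open>Every vertex set smaller than a minimal non-interval \<open>V\<close> induces an interval graph. If all
  components at a clique separator \<open>T\<close> are full, the pieces at \<open>T\<close> can be glued, unless one of
  them is a single vertex, which then is an end vertex.\<close>

lemma singleton_piece_is_end:
  assumes sym: "symp E" "irreflp E" and V: "V = insert b (F \<union> T)"
    and F: "F \<noteq> {}" "connected_set E F" "F \<inter> T = {}" "\<And>t. t \<in> T \<Longrightarrow> \<exists>f\<in>F. E t f"
    and b: "b \<notin> F" "b \<notin> T" "\<And>t. t \<in> T \<Longrightarrow> E b t" "\<And>f. f \<in> F \<Longrightarrow> \<not> E f b"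
    and T: "clique E T"
  shows "end_vertex V E b" "{v\<in>V. E b v} = T"
proof -
  have nb: "\<not> E b f" if "f \<in> F" for f
    using b(4)[OF that] sympD[OF sym(1)] by blast
  have "\<not> E b b" using sym(2) by (simp add: irreflp_def)
  then have N: "{v\<in>V. E b v} = T" and W: "{v\<in>V. v \<noteq> b \<and> \<not> E b v} = F"
    using V nb b(1-3) F(3) by auto
  then show "{v\<in>V. E b v} = T" by blast
  have "\<exists>w\<in>V. w \<noteq> b \<and> \<not> E b w \<and> E n w" if "n \<in> V" "E b n" for n
  proof -
    have "n \<in> T" using that N by blast
    then obtain f where "f \<in> F" "E n f" using F(4) by blast
    then show ?thesis using V nb[of f] b(1) by (intro bexI[of _ f]) auto
  qed
  then show "end_vertex V E b"
    unfolding end_vertex_def N W using V F T by blast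
qed

text \<open>The separator \<open>T\<close> is sought in \<open>M\<close>, where the end vertices are
  missing, and taken of least size, so that each component of \<open>M - T\<close> has neighbours of
  every vertex of \<open>T\<close>. Only the end vertices with all neighbours in \<open>T\<close>,
  \<open>Ends0\<close>, stay outside; any other one joins the component of a neighbour. The pieces
  of the remaining \<open>W\<close> are glued, and \<open>Ends0\<close> is attached at the two
  ends.\<close>

theorem chordal_at_free_interval:
  assumes "finite V" "symp E" "irreflp E" "chordal V E" "at_free V E"
  shows "interval_graph V E"
  using assms(1,4,5)
proof (induction V rule: finite_psubset_induct)
  case (psubset V)
  note sym = \<open>symp E\<close> and irr = \<open>irreflp E\<close> and fin = \<open>finite V\<close> and ch = \<open>chordal V E\<close>
    and at = \<open>at_free V E\<close>
  have symE: "\<And>x y. E x y \<Longrightarrow> E y x" using sym by (rule sympD)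
  have IH: "interval_graph U E" if "U \<subset> V" for U
    using psubset.IH[OF that] chordal_subset[OF ch, of U] at_free_subset[OF at, of U] that by blast
  define Ends where "Ends = {c. end_vertex V E c}"
  define M where "M = V - Ends"
  have EndsV: "Ends \<subseteq> V" unfolding Ends_def end_vertex_def by blast
  have nadj: "\<not> E c x" if "c \<in> Ends" "x \<in> Ends" for c x
    using end_vertices_nonadjacent[OF sym, of V c x] irr that unfolding Ends_def
    by (cases "c = x") (auto simp: irreflp_def)
  have EndsE: "v \<in> M" if "e \<in> Ends" "v \<in> V" "E e v" for e v
    using that nadj unfolding M_def by blast
  have Ncl: "clique E {v\<in>V. E e v}" if "e \<in> Ends" for e
    using that unfolding Ends_def end_vertex_def by blast
  have Wcon: "connected_set E {v\<in>V. v \<noteq> e \<and> \<not> E e v}" if "e \<in> Ends" for e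
    using that unfolding Ends_def end_vertex_def by blast
  have three: False if "x \<in> Ends" "y \<in> Ends" "z \<in> Ends" "x \<noteq> y" "x \<noteq> z" "y \<noteq> z" for x y z
    using three_end_vertices[OF sym at] that unfolding Ends_def by blast
  show ?case
  proof (cases "clique E M")
    case True
    \<comment> \<open>A clique is represented by copies of the point 0, with room for one end vertex
      on each side.\<close>
    have M0: "interval_rep M E (\<lambda>_. 0) (\<lambda>_. 0)"
      using True unfolding interval_rep_def clique_def by blast
    have finM: "finite M" unfolding M_def using fin by simp
    have NM: "clique E {v\<in>M. E e v}" if "e \<in> Ends" for e
      using True by (rule clique_subset) blast
    have cM: "E v s" if "v \<in> M" "v \<notin> {v\<in>M. E e v}" "s \<in> {v\<in>M. E e v}" for e v s
    proof -
      have "s \<in> M" "v \<noteq> s" using that by auto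
      then show ?thesis using True that(1) unfolding clique_def by blast
    qed
    have V: "V = M \<union> Ends" "M \<inter> Ends = {}" unfolding M_def using EndsV by auto
    show ?thesis
    proof (rule card_le_two_cases[of Ends])
      assume "Ends = {}"
      then show ?thesis using M0 V unfolding interval_graph_def by auto
    next
      fix c assume c: "Ends = {c}"
      have "interval_graph (insert c M) E"
        by (rule interval_rep_insert_left[OF finM sym M0 _ refl, where q = 0])
          (use c V NM cM in auto)
      then show ?thesis using c V by simp
    next
      fix c x assume c: "c \<noteq> x" "Ends = {c, x}"
      have "interval_graph (insert x (insert c M)) E"
        by (rule interval_rep_insert_both[OF finM sym M0 _ refl _ _ _ _ refl, where q = 0 and p = 0])
          (use c V NM cM nadj in auto)
      then show ?thesis using c V by (simp add: insert_commute)
    qed (use three in blast)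
  next
    case False
    define sepT where "sepT T \<longleftrightarrow> T \<subseteq> M \<and> clique E T \<and> (\<exists>A B. A \<noteq> {} \<and> B \<noteq> {} \<and> A \<union> B = M - T \<and>
      A \<inter> B = {} \<and> (\<forall>a\<in>A. \<forall>b\<in>B. \<not> E a b))" for T
    have sepTI: "sepT T" if "T \<subseteq> M" "clique E T" "A \<noteq> {}" "B \<noteq> {}" "A \<union> B = M - T"
      "A \<inter> B = {}" "\<And>a b. a \<in> A \<Longrightarrow> b \<in> B \<Longrightarrow> \<not> E a b" for T A B
      unfolding sepT_def using that by metis
    have "\<exists>T. sepT T"
    proof -
      obtain u v where uv: "u \<in> M" "v \<in> M" "u \<noteq> v" "\<not> E u v"
        using False unfolding clique_def by blast
      have "chordal M E" using ch by (rule chordal_subset) (auto simp: M_def)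
      then have "separated M E u v" using uv unfolding chordal_def by blast
      then obtain A T where AT: "A \<subseteq> M" "T \<subseteq> M" "A \<inter> T = {}" "u \<in> A" "v \<in> M - A - T" "clique E T"
        "\<forall>x\<in>A. \<forall>y\<in>M - A - T. \<not> E x y"
        unfolding separated_def by blast
      have "sepT T"
        by (rule sepTI[of T A "M - A - T"]) (use AT in auto)
      then show ?thesis ..
    qed
    then obtain T where T: "sepT T" "\<And>T'. sepT T' \<Longrightarrow> card T \<le> card T'"
      using ex_has_least_nat[of sepT _ card] by blast
    obtain A B where AB: "A \<noteq> {}" "B \<noteq> {}" "A \<union> B = M - T" "A \<inter> B = {}" "\<forall>a\<in>A. \<forall>b\<in>B. \<not> E a b"
      and TM: "T \<subseteq> M" "clique E T"
      using T(1) unfolding sepT_def by blast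
    have TV: "T \<subseteq> V" using TM unfolding M_def by blast
    have finT: "finite T" using TV fin by (rule finite_subset)
    have fullM: "\<exists>y\<in>component E (M - T) x. E t y" if x: "x \<in> M - T" and t: "t \<in> T" for x t
    proof (rule ccontr)
      assume no: "\<not> ?thesis"
      let ?Y = "component E (M - T) x"
      have Y: "?Y \<subseteq> M - T" using component_subset[OF x] .
      \<comment> \<open>A component without neighbours of \<open>t\<close> remains cut off when
        \<open>t\<close> moves to the other side, against the choice of \<open>T\<close>.\<close>
      have "sepT (T - {t})"
      proof (rule sepTI[of "T - {t}" ?Y "M - (T - {t}) - ?Y"])
        show "?Y \<noteq> {}" using component_self[of x E "M - T"] by blast
        show "M - (T - {t}) - ?Y \<noteq> {}" using t TM Y by blast
        show "\<not> E a b" if "a \<in> ?Y" "b \<in> M - (T - {t}) - ?Y" for a b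
          using no component_step[OF that(1) x, of b] symE[of a b] that by blast
        show "clique E (T - {t})" using TM(2) by (rule clique_subset) blast
      qed (use TM(1) Y in blast)+
      then have "card T \<le> card (T - {t})" by (rule T(2))
      then show False using t finT by (metis card_Diff1_less not_le)
    qed
    define Ends0 where "Ends0 = {e\<in>Ends. \<forall>v\<in>V. E e v \<longrightarrow> v \<in> T}"
    define W where "W = V - Ends0"
    have WV: "W \<subseteq> V" unfolding W_def by blast
    have TW: "T \<subseteq> W" using TM unfolding W_def M_def Ends0_def by blast
    have MW: "M \<subseteq> W" unfolding W_def M_def Ends0_def by blast
    let ?K = "component E (W - T)"
    have MK: "component E (M - T) x \<subseteq> ?K x" for x
      unfolding component_def using MW by (auto intro: conn_subset)
    have full: "\<exists>y\<in>?K x. E t y" if x: "x \<in> W - T" and t: "t \<in> T" for x t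
    proof (cases "x \<in> M")
      case True
      then show ?thesis using fullM[of x t] MK x t by blast
    next
      case False
      then have "x \<in> Ends" "x \<notin> Ends0" using x unfolding W_def M_def by auto
      then obtain m where m: "m \<in> V" "E x m" "m \<notin> T" "m \<in> M"
        unfolding Ends0_def using EndsE by blast
      then have "m \<in> ?K x" using MW x component_step[OF component_self x, of E m] by blast
      then have "?K m = ?K x" using component_eqI[OF sym] by blast
      then show ?thesis using fullM[of m t] MK[of m] m t by blast
    qed
    obtain a0 b0 where ab0: "a0 \<in> A" "b0 \<in> B" using AB by blast
    have ab0W: "a0 \<in> W - T" "b0 \<in> W - T" using ab0 AB(3) MW by blast+
    have "b0 \<notin> ?K a0"
    proof
      assume "b0 \<in> ?K a0"
      then have con: "conn E (W - T) a0 b0" by (simp add: component_def)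
      \<comment> \<open>\<open>A\<close> with the end vertices touching it is closed: an end vertex
        cannot lead from \<open>A\<close> to \<open>B\<close>, because its neighbours are pairwise
        adjacent.\<close>
      have "b0 \<in> A \<union> {e\<in>Ends. \<exists>a\<in>A. E e a}"
      proof (rule conn_closed[OF con])
        fix p q assume pq: "p \<in> A \<union> {e\<in>Ends. \<exists>a\<in>A. E e a}" "q \<in> W - T" "E p q"
        show "q \<in> A \<union> {e\<in>Ends. \<exists>a\<in>A. E e a}"
        proof (cases "p \<in> A")
          case True
          show ?thesis
          proof (cases "q \<in> M")
            case qM: True
            then have "q \<in> A \<union> B" using AB(3) pq(2) by blast
            then show ?thesis using AB(5) True pq(3) by blast
          next
            case False
            then have "q \<in> Ends" using pq(2) WV unfolding M_def by blast
            then show ?thesis using True symE[OF pq(3)] by blast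
          qed
        next
          case False
          then obtain a where a: "p \<in> Ends" "a \<in> A" "E p a" using pq(1) by blast
          have qM: "q \<in> M" using EndsE[OF a(1) _ pq(3)] pq(2) WV by blast
          then have q: "q \<in> A \<union> B" using AB(3) pq(2) by blast
          moreover have "q \<notin> B"
          proof
            assume "q \<in> B"
            moreover have "a \<in> V" "q \<in> V" using a(2) AB(3) qM unfolding M_def by blast+
            moreover have "a \<noteq> q" using \<open>q \<in> B\<close> a(2) AB(4) by blast
            ultimately have "E a q" using Ncl[OF a(1)] a(3) pq(3) unfolding clique_def by blast
            then show False using AB(5) a(2) \<open>q \<in> B\<close> by blast
          qed
          ultimately show ?thesis by blast
        qed
      qed (use ab0 in blast)
      moreover have "b0 \<notin> Ends" using ab0 AB(3) unfolding M_def by blast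
      ultimately show False using ab0 AB(4) by blast
    qed
    then have Kne: "?K a0 \<noteq> ?K b0" using component_self[of b0 E "W - T"] by metis
    have finW: "finite W" using WV fin by (rule finite_subset)
    obtain F1 F2 Z b1 b2 where
      W: "W = F1 \<union> F2 \<union> Z \<union> T" and disj: "F1 \<inter> T = {}" "F2 \<inter> T = {}" "Z \<inter> T = {}" "F1 \<inter> F2 = {}" "F1 \<inter> Z = {}"
      "F2 \<inter> Z = {}" and
      na': "\<forall>x\<in>F1. \<forall>y\<in>F2. \<not> E x y" "\<forall>x\<in>F1. \<forall>y\<in>Z. \<not> E x y"
      "\<forall>x\<in>F2. \<forall>y\<in>Z. \<not> E x y" and ZT': "\<forall>z\<in>Z. \<forall>t\<in>T. E z t" and
      con: "connected_set E F1" "connected_set E F2" and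
      b1': "b1 \<in> F1" "\<forall>t\<in>T. E b1 t" and
      b2': "b2 \<in> F2" "\<forall>t\<in>T. E b2 t"
      by (rule split_at_full_separator[OF sym at_free_subset[OF at WV] chordal_subset[OF ch WV] finW TW TM(2)
            full ab0W Kne])
    note na = na'[rule_format] and ZT = ZT'[rule_format] and b1 = b1'[rule_format] and b2 = b2'[rule_format]
    have fullF1: "\<exists>f\<in>F1. E t f" and fullF2: "\<exists>f\<in>F2. E t f" if "t \<in> T" for t
      using b1 b2 that symE by blast+
    have finZ: "finite Z" using finW W by simp
    have "Z \<subset> V" using W b1(1) disj(5) WV by blast
    then have Zint: "interval_graph Z E" by (rule IH)
    have asm: "\<exists>l r N. interval_rep (F1 \<union> F2 \<union> Z \<union> T) E l r \<and> 0 < N \<and> (\<forall>f\<in>F1. r f < 0) \<and>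
        (\<forall>f\<in>F2. N < l f) \<and> (\<forall>z\<in>Z. 0 < l z \<and> r z < N) \<and> (\<forall>t\<in>T. l t \<le> 0 \<and> N \<le> r t)"
      if "insert b2 (F1 \<union> T) \<subset> V" "insert b1 (F2 \<union> T) \<subset> V"
      by (rule interval_rep_assemble[OF sym TM(2) finZ disj na ZT Zint con(1) IH[OF that(1)] b1 con(2)
            IH[OF that(2)] b2]) blast+
    show ?thesis
    proof (cases "Ends0 = {}")
      case True
      then have WeqV: "W = V" unfolding W_def by blast
      \<comment> \<open>Otherwise the anchor would be an end vertex with neighbourhood
        \<open>T\<close> and thus belong to \<open>Ends0\<close>.\<close>
      have "insert b2 (F1 \<union> T) \<noteq> V"
      proof
        assume V: "insert b2 (F1 \<union> T) = V"
        have b: "F1 \<noteq> {}" "b2 \<notin> F1" "b2 \<notin> T" "\<And>f. f \<in> F1 \<Longrightarrow> \<not> E f b2"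
          using b1(1) b2(1) disj(2,4) na(1) by auto
        note singleton_piece_is_end[OF sym irr V[symmetric] b(1) con(1) disj(1) fullF1 b(2,3) b2(2) b(4) TM(2)]
        then show False using True unfolding Ends0_def Ends_def by blast
      qed
      moreover have "insert b1 (F2 \<union> T) \<noteq> V"
      proof
        assume V: "insert b1 (F2 \<union> T) = V"
        have b: "F2 \<noteq> {}" "b1 \<notin> F2" "b1 \<notin> T" "\<And>f. f \<in> F2 \<Longrightarrow> \<not> E f b1"
          using b1(1) b2(1) disj(1,4) na(1) by (auto dest: symE)
        note singleton_piece_is_end[OF sym irr V[symmetric] b(1) con(2) disj(2) fullF2 b(2,3) b1(2) b(4) TM(2)]
        then show False using True unfolding Ends0_def Ends_def by blast
      qed
      ultimately have proper: "insert b2 (F1 \<union> T) \<subset> V" "insert b1 (F2 \<union> T) \<subset> V"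
        using W WeqV b1 b2 by blast+
      obtain l r where "interval_rep (F1 \<union> F2 \<union> Z \<union> T) E l r"
        using asm[OF proper] by blast
      then show ?thesis using W WeqV unfolding interval_graph_def by blast
    next
      case False
      then have "W \<subset> V" unfolding W_def Ends0_def using EndsV by blast
      then have proper: "insert b2 (F1 \<union> T) \<subset> V" "insert b1 (F2 \<union> T) \<subset> V"
        using W b1 b2 by blast+
      obtain l r N where rep': "interval_rep (F1 \<union> F2 \<union> Z \<union> T) E l r" and N: "0 < N"
        and rl: "\<forall>f\<in>F1. r f < 0" "\<forall>f\<in>F2. N < l f" "\<forall>z\<in>Z. 0 < l z \<and> r z < N"
          "\<forall>t\<in>T. l t \<le> 0 \<and> N \<le> r t"
        using asm[OF proper] by blast
      note F1 = rl(1)[rule_format] and F2 = rl(2)[rule_format] and Z = rl(3)[rule_format]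
        and Trep = rl(4)[rule_format]
      have rep: "interval_rep W E l r" using rep' W by simp
      define S where "S e = {v\<in>W. E e v}" for e
      have E0: "e \<in> Ends" "e \<in> V" "e \<notin> W" if "e \<in> Ends0" for e
        using that EndsV unfolding Ends0_def W_def by auto
      have S_eq: "S e = {v\<in>V. E e v}" if "e \<in> Ends0" for e
        using that TW unfolding S_def Ends0_def W_def by blast
      have ST: "S e \<subseteq> T" if "e \<in> Ends0" for e
        using that unfolding S_eq[OF that] Ends0_def by blast
      have Scl: "clique E (S e)" if "e \<in> Ends0" for e
        using TM(2) ST[OF that] by (rule clique_subset)
      have eF: "\<not> E e v" "\<not> E v e" if "e \<in> Ends0" "v \<in> V" "v \<notin> T" for e v
        using that symE unfolding Ends0_def by blast+
      \<comment> \<open>If \<open>e\<close> were adjacent to all of \<open>T\<close>, its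
        non-neighbours, which include \<open>F1\<close> and \<open>F2\<close>, would be
        disconnected, as edges leaving \<open>F1\<close> within \<open>W\<close> enter
        \<open>T\<close>.\<close>
      have Sne: "\<exists>t\<in>T. \<not> E e t" if e: "e \<in> Ends0" for e
      proof (rule ccontr)
        assume all: "\<not> ?thesis"
        let ?U = "{v\<in>V. v \<noteq> e \<and> \<not> E e v}"
        have "F1 \<subseteq> ?U" "F2 \<subseteq> ?U"
          using eF(1)[OF e] disj W WV E0[OF e] by blast+
        then have "b1 \<in> ?U" "b2 \<in> ?U" "b2 \<notin> F1" using b1 b2 disj by blast+
        then obtain p q where pq: "p \<in> F1" "q \<in> ?U" "q \<notin> F1" "E p q"
          using connected_exit[OF Wcon[OF E0(1)[OF e]], of b1 b2 F1] b1(1) by metis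
        have "q \<notin> T" using pq all by blast
        show False
        proof (cases "q \<in> W")
          case True
          then have "q \<in> F2 \<union> Z" using W pq \<open>q \<notin> T\<close> by blast
          then show False using na(1,2) pq by blast
        next
          case False
          then have "q \<in> Ends0" using pq unfolding W_def by blast
          then show False using eF(2)[of q p] pq(1,4) W WV disj by blast
        qed
      qed
      \<comment> \<open>If \<open>F\<close> is complete to the neighbours of \<open>e\<close>, these
        can be prolonged past \<open>F\<close> without new adjacencies, and \<open>e\<close> can be
        attached there.\<close>
      define comp where "comp F e \<longleftrightarrow> (\<forall>f\<in>F. \<forall>s\<in>S e. E f s)" for F e
      \<comment> \<open>Otherwise \<open>x1\<close>, \<open>x2\<close>, \<open>e\<close> are an
        asteroidal triple: \<open>e\<close> reaches \<open>F1\<close> through \<open>s1\<close>,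
        which \<open>x2\<close> misses, and \<open>F2\<close> through \<open>s2\<close>, which
        \<open>x1\<close> misses, while \<open>F1\<close> and \<open>F2\<close> are joined through a
        \<open>t\<close> that \<open>e\<close> misses.\<close>
      have one: "comp F1 e \<or> comp F2 e" if e: "e \<in> Ends0" for e
      proof (rule ccontr)
        assume "\<not> ?thesis"
        then obtain x1 s2 x2 s1 where x: "x1 \<in> F1" "s2 \<in> S e" "\<not> E x1 s2" "x2 \<in> F2" "s1 \<in> S e" "\<not> E x2 s1"
          unfolding comp_def by blast
        obtain t where t: "t \<in> T" "\<not> E e t" using Sne[OF e] by blast
        have s: "s1 \<in> T" "E e s1" "s2 \<in> T" "E e s2"
          using x ST[OF e] unfolding S_def by auto
        have side: "connected_set E (insert e (insert s F))"
          if "connected_set E F" "\<exists>f\<in>F. E s f" "E e s" for s F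
        proof -
          have "connected_set E (insert s F)" using that connected_insert[OF sym] by blast
          then show ?thesis using connected_insert[OF sym, of "insert s F" s e] that by blast
        qed
        have FV: "F1 \<subseteq> V - T" "F2 \<subseteq> V - T" using W WV disj by auto
        have xV: "x1 \<in> V" "x2 \<in> V" "x1 \<notin> T" "x2 \<notin> T" using FV x by auto
        have n12: "\<not> E x1 f" if "f \<in> F2" for f using na(1)[OF x(1) that] .
        have n21: "\<not> E x2 f" if "f \<in> F1" for f using na(1)[OF that x(4)] symE by blast
        show False
        proof (rule at_freeD[OF at xV(1,2) E0(2)[OF e]])
          show "connected_set E (insert t (F1 \<union> F2))"
            using connected_bridge[OF sym con] fullF1[OF t(1)] fullF2[OF t(1)] by blast
          show "connected_set E (insert e (insert s1 F1))" "connected_set E (insert e (insert s2 F2))"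
            using side con fullF1 fullF2 s by blast+
          show "x1 \<noteq> x2" using x disj by blast
          show "x1 \<noteq> e" "x2 \<noteq> e" using x E0(3)[OF e] W by blast+
          show "\<not> E x1 x2" using n12 x by blast
          show "\<not> E x1 e" "\<not> E x2 e" using eF(2)[OF e] xV by blast+
          show "\<not> E e p" if "p \<in> insert t (F1 \<union> F2)" for p
            using that t eF(1)[OF e] FV by blast
          show "\<not> E x2 p" if "p \<in> insert e (insert s1 F1)" for p
            using that x n21 eF(2)[OF e] xV by blast
          show "\<not> E x1 p" if "p \<in> insert e (insert s2 F2)" for p
            using that x n12 eF(2)[OF e] xV by blast
        qed (use x FV TV s t E0(2)[OF e] in auto)
      qed
      have right1: "N \<le> r s" if "e \<in> Ends0" "s \<in> S e" for e s
        using Trep ST that by blast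
      have right2: "E v s" if "comp F2 e" "e \<in> Ends0" "v \<in> W" "v \<notin> S e" "N \<le> r v" "s \<in> S e" for e v s
      proof -
        have v: "v \<in> T \<or> v \<in> F2" using F1[of v] Z[of v] N that(3,5) W by force
        have "s \<in> T" "v \<noteq> s" using that ST by auto
        then have "E v s" if "v \<in> T" using TM(2) that unfolding clique_def by blast
        then show ?thesis using v that(1,6) unfolding comp_def by blast
      qed
      have left1: "l s \<le> 0" if "e \<in> Ends0" "s \<in> S e" for e s
        using Trep ST that by blast
      have left2: "E v s" if "comp F1 e" "e \<in> Ends0" "v \<in> W" "v \<notin> S e" "l v \<le> 0" "s \<in> S e" for e v s
      proof -
        have v: "v \<in> T \<or> v \<in> F1" using F2[of v] Z[of v] N that(3,5) W by force
        have "s \<in> T" "v \<noteq> s" using that ST by auto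
        then have "E v s" if "v \<in> T" using TM(2) that unfolding clique_def by blast
        then show ?thesis using v that(1,6) unfolding comp_def by blast
      qed
      have both: "interval_graph (insert x (insert c W)) E"
        if "c \<in> Ends0" "x \<in> Ends0" "c \<noteq> x" "comp F2 c" "comp F1 x" for c x
        by (rule interval_rep_insert_both[OF finW sym rep E0(3)[OF that(1)] S_def Scl[OF that(1)] right1[OF that(1)]
              right2[OF that(4,1)] E0(3)[OF that(2)] S_def Scl[OF that(2)] left1[OF that(2)] left2[OF that(5,2)]])
          (use N that nadj E0(1) in auto)
      have V: "V = W \<union> Ends0" unfolding W_def Ends0_def using EndsV by blast
      show ?thesis
      proof (rule card_le_two_cases[of Ends0])
        assume "Ends0 = {}"
        then show ?thesis using False by blast
      next
        fix c assume c: "Ends0 = {c}"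
        then have c0: "c \<in> Ends0" by blast
        have "interval_graph (insert c W) E"
        proof (cases "comp F1 c")
          case True
          show ?thesis
            by (rule interval_rep_insert_left[OF finW sym rep E0(3)[OF c0] S_def Scl[OF c0] left1[OF c0] left2[OF True c0]])
        next
          case False
          then have "comp F2 c" using one[OF c0] by blast
          then obtain l' r' where "interval_rep (insert c W) E l' r'"
            using interval_rep_insert_right[OF finW sym rep E0(3)[OF c0] S_def Scl[OF c0] right1[OF c0] right2[OF _ c0]]
            by blast
          then show ?thesis unfolding interval_graph_def by blast
        qed
        then show ?thesis using V c by simp
      next
        fix c x assume cx: "c \<noteq> x" "Ends0 = {c, x}"
        then have c0: "c \<in> Ends0" "x \<in> Ends0" by auto
        have ends: "end_vertex V E c" "end_vertex V E x" using E0(1) c0 unfolding Ends_def by auto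
        have cT: "v \<in> T" if "v \<in> V" "E c v" for v using that c0 unfolding Ends0_def by blast
        have xT: "v \<in> T" if "v \<in> V" "E x v" for v using that c0 unfolding Ends0_def by blast
        have notF: "c \<notin> F1" "c \<notin> F2" "x \<notin> F1" "x \<notin> F2" using E0(3) c0 W by auto
        have FV: "F1 \<subseteq> V" "F2 \<subseteq> V" using W WV by auto
        have no1: "comp F1 c \<or> comp F1 x"
        proof (rule ccontr)
          assume "\<not> ?thesis"
          then obtain f s f' s' where f: "f \<in> F1" "s \<in> S c" "\<not> E f s" "f' \<in> F1" "s' \<in> S x" "\<not> E f' s'"
            unfolding comp_def by blast
          \<comment> \<open>The neighbourhoods in \<open>T\<close> of vertices of \<open>F1\<close>
            are nested by right ends; so of \<open>f\<close> and \<open>f'\<close> the one that ends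
            first misses both \<open>s\<close> and \<open>s'\<close>.\<close>
          have adj: "E g t \<longleftrightarrow> l t \<le> r g" if "g \<in> F1" "t \<in> T" for g t
            using interval_rep_adj[OF rep, of g t] interval_rep_le[OF rep, of g] F1[of g] Trep[of t] N that W disj
            by force
          have sT: "s \<in> T" "s' \<in> T" using f ST c0 by auto
          obtain g where "g \<in> F1" "\<not> E g s" "\<not> E g s'"
          proof (cases "r f \<le> r f'")
            case True
            then show ?thesis using that[of f] f adj sT by (metis order_trans)
          next
            case False
            then show ?thesis using that[of f'] f adj sT by (metis order_trans linear)
          qed
          then show False
            using two_ends_same_side[OF sym at ends cx(1) con(1) FV(1) disj(1) fullF1 notF(1,3) TM(2) TV cT xT, of g s s']
              f S_eq[OF c0(1)] S_eq[OF c0(2)] by auto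
        qed
        have no2: "comp F2 c \<or> comp F2 x"
        proof (rule ccontr)
          assume "\<not> ?thesis"
          then obtain f s f' s' where f: "f \<in> F2" "s \<in> S c" "\<not> E f s" "f' \<in> F2" "s' \<in> S x" "\<not> E f' s'"
            unfolding comp_def by blast
          have adj: "E g t \<longleftrightarrow> l g \<le> r t" if "g \<in> F2" "t \<in> T" for g t
            using interval_rep_adj[OF rep, of g t] interval_rep_le[OF rep, of g] F2[of g] Trep[of t] N that W disj
            by force
          have sT: "s \<in> T" "s' \<in> T" using f ST c0 by auto
          obtain g where "g \<in> F2" "\<not> E g s" "\<not> E g s'"
          proof (cases "l f' \<le> l f")
            case True
            then show ?thesis using that[of f] f adj sT by (metis order_trans)
          next
            case False
            then show ?thesis using that[of f'] f adj sT by (metis order_trans linear)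
          qed
          then show False
            using two_ends_same_side[OF sym at ends cx(1) con(2) FV(2) disj(2) fullF2 notF(2,4) TM(2) TV cT xT, of g s s']
              f S_eq[OF c0(1)] S_eq[OF c0(2)] by auto
        qed
        \<comment> \<open>Each end vertex fits on some side, and each side fits some end vertex; so
          the two can be placed on different sides.\<close>
        have "comp F2 c \<and> comp F1 x \<or> comp F2 x \<and> comp F1 c"
          using no1 no2 one[OF c0(1)] one[OF c0(2)] by blast
        then have "interval_graph (insert x (insert c W)) E"
          using both[OF c0 cx(1)] both[OF c0(2,1) cx(1)[symmetric]] by (metis insert_commute)
        then show ?thesis using V cx by (simp add: insert_commute)
      qed (use three E0(1) in blast)
    qed
  qed
qed

section \<open>Claws in minimal triangulations\<close>

text \<open>For \<open>r u < l v\<close>, the intervals that contain the point \<open>r u\<close>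
  and go beyond it form a clique. It separates the intervals ending by \<open>r u\<close> from those
  starting later.\<close>

lemma interval_rep_chordal:
  assumes sym: "symp J" and rep: "interval_rep V J l r"
  shows "chordal V J"
proof -
  have sep: "separated V J u v" if uv: "u \<in> V" "v \<in> V" "r u < l v" for u v
  proof (rule separatedI[of "{x\<in>V. r x \<le> r u}" V "{x\<in>V. l x \<le> r u \<and> r u < r x}"])
    show "clique J {x\<in>V. l x \<le> r u \<and> r u < r x}"
      unfolding clique_def
    proof (intro ballI impI)
      fix x y assume "x \<in> {x\<in>V. l x \<le> r u \<and> r u < r x}" "y \<in> {x\<in>V. l x \<le> r u \<and> r u < r x}" "x \<noteq> y"
      then show "J x y" using interval_rep_adj[OF rep, of x y] by auto
    qed
    show "\<not> J x y" if "x \<in> {x\<in>V. r x \<le> r u}" "y \<in> V" "y \<notin> {x\<in>V. r x \<le> r u}"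
      "y \<notin> {x\<in>V. l x \<le> r u \<and> r u < r x}" for x y
    proof -
      have "x \<noteq> y" "r x < l y" using that by auto
      then show ?thesis using interval_rep_adj[OF rep, of x y] that by auto
    qed
  qed (use uv interval_rep_le[OF rep, of v] in auto)
  show ?thesis
    unfolding chordal_def
  proof (intro ballI impI)
    fix u v assume uv: "u \<in> V" "v \<in> V" "u \<noteq> v \<and> \<not> J u v"
    then have "r u < l v \<or> r v < l u" using interval_rep_adj[OF rep, of u v] by auto
    then show "separated V J u v"
      using sep[of u v] separated_sym[OF sym sep[of v u]] uv by blast
  qed
qed

text \<open>The endpoints are parameters so that \<open>mirror\<close> can turn a fact about left
  sides into one about right sides.\<close>

locale interval_fill =
  fixes V :: "'a set" and G H :: "'a \<Rightarrow> 'a \<Rightarrow> bool" and l r :: "'a \<Rightarrow> real"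
  assumes symG: "symp G" and irrG: "irreflp G" and GH: "\<And>u v. G u v \<Longrightarrow> H u v"
    and minf: "min_fill V G H" and rep: "interval_rep V H l r"
begin

lemma mirror: "interval_fill V G H (\<lambda>v. - r v) (\<lambda>v. - l v)"
  using symG irrG GH minf interval_rep_mirror[OF rep] by unfold_locales auto

lemma adjI: "u \<in> V \<Longrightarrow> v \<in> V \<Longrightarrow> u \<noteq> v \<Longrightarrow> l u \<le> r v \<Longrightarrow> l v \<le> r u \<Longrightarrow> H u v"
  using interval_rep_adj[OF rep] by blast

lemma G_meet:
  assumes "u \<in> V" "v \<in> V" "G u v"
  shows "l u \<le> r v" "l v \<le> r u"
proof -
  have "u \<noteq> v" using assms irrG by (auto simp: irreflp_def)
  then show "l u \<le> r v" "l v \<le> r u"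
    using interval_rep_adj[OF rep, of u v] assms GH by blast+
qed

lemma le: "v \<in> V \<Longrightarrow> l v \<le> r v"
  using rep by (rule interval_rep_le)

text \<open>The outer \<open>G\<close>-neighbours of the component all contain the point
  \<open>r x\<close> and reach beyond it, so they form a clique of \<open>H\<close>. If
  \<open>a\<close> were not among them, minimality would make \<open>x\<close> and \<open>a\<close>
  non-adjacent in \<open>H\<close>, but their intervals meet.\<close>

lemma ex_left_neighbour:
  assumes x: "x \<in> V" "a \<in> V" "l a \<le> r x" "r x < r a"
  shows "\<exists>y\<in>component G {v\<in>V. r v \<le> r x} x. G a y"
proof (rule ccontr)
  assume no: "\<not> ?thesis"
  let ?L = "component G {v\<in>V. r v \<le> r x} x"
  define S where "S = {v\<in>V. l v \<le> r x \<and> r x < r v} - {a}"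
  have xX: "x \<in> {v\<in>V. r v \<le> r x}" using x by simp
  have L: "?L \<subseteq> {v\<in>V. r v \<le> r x}" by (rule component_subset[OF xX])
  have ne: "x \<noteq> a" using x by auto
  have "\<not> H x a"
  proof (rule min_fillD[OF minf, of ?L S])
    show "clique H S"
      unfolding clique_def S_def by (auto intro: adjI)
    show "\<not> G c y" if c: "c \<in> ?L" and y: "y \<in> V" "y \<notin> ?L" "y \<notin> S" for c y
    proof
      assume cy: "G c y"
      have c': "c \<in> V" "r c \<le> r x" using L c by auto
      have "r x < r y"
        using component_step[OF c xX cy] y by fastforce
      moreover have "l y \<le> r x" using G_meet(2)[OF c'(1) y(1) cy] c'(2) by linarith
      ultimately have "y = a" using y unfolding S_def by blast
      then show False using no c sympD[OF symG cy] by blast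
    qed
  qed (use L x in \<open>auto simp: S_def\<close>)
  moreover have "H x a" using adjI[OF x(1,2) ne] le[OF x(1)] x(3,4) by linarith
  ultimately show False by blast
qed

lemma ex_right_neighbour:
  assumes "x \<in> V" "a \<in> V" "l a < l x" "l x \<le> r a"
  shows "\<exists>y\<in>component G {v\<in>V. l x \<le> l v} x. G a y"
  using interval_fill.ex_left_neighbour[OF mirror, of x a] assms by simp

text \<open>Otherwise \<open>u\<close> has no neighbour in \<open>C\<close>, the
  \<open>G\<close>-component of \<open>x2\<close> among the intervals strictly between
  \<open>x1\<close> and \<open>x3\<close>. Since \<open>x2\<close> and \<open>u\<close> meet,
  minimality shows that the outer \<open>G\<close>-neighbours of \<open>C\<close> are no clique of
  \<open>H\<close>. Two disjoint ones are \<open>a\<close>, crossing the right end of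
  \<open>x1\<close>, and \<open>b\<close>, crossing the left end of \<open>x3\<close>. Then
  \<open>x1\<close>, \<open>x2\<close>, \<open>x3\<close> is an asteroidal triple of
  \<open>G\<close>, joined through \<open>a\<close>, through \<open>b\<close> and, from
  \<open>x1\<close> to \<open>x3\<close>, through \<open>u\<close>.\<close>

lemma replace_middle_leaf:
  assumes at: "at_free V G" and V: "u \<in> V" "x1 \<in> V" "x2 \<in> V" "x3 \<in> V"
    and x: "r x1 < l x2" "r x2 < l x3" and u: "l u \<le> r x1" "l x3 \<le> r u"
  shows "\<exists>y\<in>V. G u y \<and> r x1 < l y \<and> r y < l x3"
proof (rule ccontr)
  assume no: "\<not> ?thesis"
  define X where "X = {v\<in>V. r x1 < l v \<and> r v < l x3}"
  define C where "C = component G X x2"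
  define L where "L = component G {v\<in>V. r v \<le> r x1} x1"
  define R where "R = component G {v\<in>V. l x3 \<le> l v} x3"
  have x2X: "x2 \<in> X" unfolding X_def using V x by simp
  have x13: "x1 \<in> {v\<in>V. r v \<le> r x1}" "x3 \<in> {v\<in>V. l x3 \<le> l v}" using V by auto
  have sub: "C \<subseteq> X" "L \<subseteq> {v\<in>V. r v \<le> r x1}" "R \<subseteq> {v\<in>V. l x3 \<le> l v}"
    unfolding C_def L_def R_def using component_subset x2X x13 by metis+
  have con: "connected_set G C" "connected_set G L" "connected_set G R"
    unfolding C_def L_def R_def using connected_component[OF symG] x2X x13 by metis+
  have self: "x2 \<in> C" "x1 \<in> L" "x3 \<in> R" unfolding C_def L_def R_def by simp_all
  have le': "l x1 \<le> r x1" "l x2 \<le> r x2" "l x3 \<le> r x3" using le V by auto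
  have uC: "\<not> G u c" if "c \<in> C" for c using no that sub(1) unfolding X_def by blast
  have nbL: "\<exists>y\<in>L. G a y" if "a \<in> V" "l a \<le> r x1" "r x1 < r a" for a
    unfolding L_def using ex_left_neighbour[OF V(2) that] .
  have nbR: "\<exists>y\<in>R. G a y" if "a \<in> V" "l a < l x3" "l x3 \<le> r a" for a
    unfolding R_def using ex_right_neighbour[OF V(4) that] .
  define S where "S = {s\<in>V - C. \<exists>c\<in>C. G c s}"
  have S: "l s \<le> r x1 \<and> r x1 < r s \<or> l s < l x3 \<and> l x3 \<le> r s" "r x1 < r s" "l s < l x3" if s: "s \<in> S" for s
  proof -
    obtain c where c: "c \<in> C" "G c s" "s \<in> V" "s \<notin> C" using s unfolding S_def by blast
    have cX: "c \<in> V" "r x1 < l c" "r c < l x3" using c(1) sub(1) unfolding X_def by auto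
    have "s \<notin> X" using component_step[of c G X x2 s] x2X c unfolding C_def by blast
    moreover show "r x1 < r s" "l s < l x3" using G_meet[OF cX(1) c(3,2)] cX by linarith+
    ultimately show "l s \<le> r x1 \<and> r x1 < r s \<or> l s < l x3 \<and> l x3 \<le> r s"
      using c(3) unfolding X_def by auto
  qed
  have "\<not> clique H S"
  proof
    assume cl: "clique H S"
    have "\<not> H x2 u"
    proof (rule min_fillD[OF minf _ _ _ cl, of C])
      show "u \<notin> C" using sub(1) u x le' unfolding X_def by auto
      show "u \<notin> S" using uC sympD[OF symG] unfolding S_def by blast
    qed (use sub(1) self V in \<open>auto simp: X_def S_def\<close>)
    moreover have "x2 \<noteq> u" using u x le' by auto
    then have "H x2 u" using adjI[OF V(3,1)] u x le' by linarith
    ultimately show False by blast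
  qed
  then obtain s t where st: "s \<in> S" "t \<in> S" "s \<noteq> t" "\<not> H s t" unfolding clique_def by blast
  have stV: "s \<in> V" "t \<in> V" using st unfolding S_def by auto
  have lt: "r s < l t \<or> r t < l s" using adjI[OF stV st(3)] st(4) by linarith
  obtain a b where ab: "a \<in> S" "b \<in> S" "r a < l b"
    using lt st by blast
  have abV: "a \<in> V" "b \<in> V" using ab unfolding S_def by auto
  have a: "l a \<le> r x1" "r x1 < r a" "r a < l x3" and b: "l b < l x3" "l x3 \<le> r b" "r x1 < l b"
    using S[OF ab(1)] S[OF ab(2)] ab(3) le[OF abV(1)] le[OF abV(2)] by auto
  have neG: "\<not> G p q" if "p \<in> V" "q \<in> V" "r p < l q \<or> r q < l p" for p q
    using G_meet[of p q] that by auto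
  obtain ca cb where c: "ca \<in> C" "G a ca" "cb \<in> C" "G b cb"
    using ab sympD[OF symG] unfolding S_def by blast
  obtain la lu rb ru where n: "la \<in> L" "G a la" "lu \<in> L" "G u lu" "rb \<in> R" "G b rb" "ru \<in> R" "G u ru"
    using nbL[OF abV(1) a(1,2)] nbL[OF V(1) u(1)] nbR[OF abV(2) b(1,2)] nbR[OF V(1) _ u(2)] u x le'
    by fastforce
  have Lb: "p \<in> V" "r p \<le> r x1" if "p \<in> L" for p using sub(2) that by auto
  have Rb: "p \<in> V" "l x3 \<le> l p" if "p \<in> R" for p using sub(3) that by auto
  have Cb: "p \<in> V" "r x1 < l p" "r p < l x3" if "p \<in> C" for p using sub(1) that unfolding X_def by auto
  show False
  proof (rule at_freeD[OF at V(2,3,4)])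
    show "connected_set G (insert a (L \<union> C))" using connected_bridge[OF symG con(2,1)] n c by blast
    show "connected_set G (insert u (L \<union> R))" using connected_bridge[OF symG con(2,3)] n by blast
    show "connected_set G (insert b (C \<union> R))" using connected_bridge[OF symG con(1,3)] n c by blast
    show "x1 \<noteq> x2" "x1 \<noteq> x3" "x2 \<noteq> x3" using x le' by auto
    show "\<not> G x1 x2" "\<not> G x1 x3" "\<not> G x2 x3" using neG V x le' by auto
    show "\<not> G x3 p" if "p \<in> insert a (L \<union> C)" for p
      using that neG[of x3 p] V abV a Lb Cb x le' by fastforce
    show "\<not> G x2 p" if "p \<in> insert u (L \<union> R)" for p
      using that neG[of x2 p] V Lb Rb x le' uC[OF self(1)] sympD[OF symG, of x2 u] by fastforce
    show "\<not> G x1 p" if "p \<in> insert b (C \<union> R)" for p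
      using that neG[of x1 p] V abV b Rb Cb x le' by fastforce
  qed (use self V abV Lb Rb Cb in auto)
qed

text \<open>The leaves are replaced from left to right. Each new one stays clear of the leaves on
  both sides of it, so the chain remains ordered, and disjoint intervals are non-adjacent in
  \<open>G\<close>. For the two outer leaves minimality suffices; the middle ones need
  AT-freeness.\<close>

lemma claw_transfer:
  assumes at: "at_free V G" and u: "u \<in> V" and m: "2 \<le> m"
    and x: "\<And>i. i < m \<Longrightarrow> x i \<in> V" "\<And>i. i < m \<Longrightarrow> l u \<le> r (x i) \<and> l (x i) \<le> r u"
      "\<And>i. Suc i < m \<Longrightarrow> r (x i) < l (x (Suc i))"
  shows "\<exists>S\<subseteq>V. card S = m \<and> (\<forall>s\<in>S. G u s) \<and> (\<forall>s\<in>S. \<forall>t\<in>S. \<not> G s t)"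
proof -
  define leaves where "leaves k y \<longleftrightarrow> (\<forall>i<m. y i \<in> V \<and> l u \<le> r (y i) \<and> l (y i) \<le> r u) \<and>
    (\<forall>i. Suc i < m \<longrightarrow> r (y i) < l (y (Suc i))) \<and> (\<forall>i<k. G u (y i))" for k and y :: "nat \<Rightarrow> 'a"
  have "\<exists>y. leaves k y" if "k \<le> m" for k
    using that
  proof (induction k)
    case 0
    then show ?case unfolding leaves_def using x by blast
  next
    case (Suc k)
    then obtain y where "leaves k y" by auto
    then have y: "\<And>i. i < m \<Longrightarrow> y i \<in> V \<and> l u \<le> r (y i) \<and> l (y i) \<le> r u"
      "\<And>i. Suc i < m \<Longrightarrow> r (y i) < l (y (Suc i))" "\<And>i. i < k \<Longrightarrow> G u (y i)"
      unfolding leaves_def by auto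
    have k: "k < m" using Suc by simp
    have "\<exists>z\<in>V. G u z \<and> (0 < k \<longrightarrow> r (y (k - 1)) < l z) \<and> (Suc k < m \<longrightarrow> r z < l (y (Suc k)))"
    proof -
      consider "k = 0" | "Suc k = m" "0 < k" | "0 < k" "Suc k < m" using k by linarith
      then show ?thesis
      proof cases
        case 1
        then have lt: "r (y 0) < l (y 1)" using y(2)[of 0] m by simp
        \<comment> \<open>\<open>2 \<le> m\<close> enters here: the second leaf makes
          \<open>u\<close> reach beyond the first.\<close>
        have V: "y 0 \<in> V" "y 1 \<in> V" "l u \<le> r (y 0)" "r (y 0) < r u" using y(1)[of 0] y(1)[of 1] m lt by auto
        obtain z where z: "z \<in> component G {v\<in>V. r v \<le> r (y 0)} (y 0)" "G u z"
          using ex_left_neighbour[OF V(1) u V(3,4)] by blast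
        moreover have "component G {v\<in>V. r v \<le> r (y 0)} (y 0) \<subseteq> {v\<in>V. r v \<le> r (y 0)}"
          by (rule component_subset) (use V in simp)
        ultimately show ?thesis using 1 lt by force
      next
        case 2
        then have lt: "r (y (k - 1)) < l (y k)" using y(2)[of "k - 1"] by simp
        have V: "y k \<in> V" "l u < l (y k)" "l (y k) \<le> r u" using y(1)[OF k] y(1)[OF less_imp_diff_less[OF k, of 1]] lt by auto
        obtain z where z: "z \<in> component G {v\<in>V. l (y k) \<le> l v} (y k)" "G u z"
          using ex_right_neighbour[OF V(1) u V(2,3)] by blast
        moreover have "component G {v\<in>V. l (y k) \<le> l v} (y k) \<subseteq> {v\<in>V. l (y k) \<le> l v}"
          by (rule component_subset) (use V in simp)
        ultimately show ?thesis using 2 lt by force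
      next
        case 3
        then have lt: "r (y (k - 1)) < l (y k)" "r (y k) < l (y (Suc k))"
          using y(2)[of "k - 1"] y(2)[of k] by simp_all
        have "\<exists>z\<in>V. G u z \<and> r (y (k - 1)) < l z \<and> r z < l (y (Suc k))"
          by (rule replace_middle_leaf[OF at u _ _ _ lt])
            (use y(1)[of "k - 1"] y(1)[of k] y(1)[of "Suc k"] 3 in auto)
        then show ?thesis using 3 by blast
      qed
    qed
    then obtain z where z: "z \<in> V" "G u z" "0 < k \<Longrightarrow> r (y (k - 1)) < l z" "Suc k < m \<Longrightarrow> r z < l (y (Suc k))"
      by blast
    have "leaves (Suc k) (y(k := z))"
      unfolding leaves_def
    proof (intro conjI allI impI)
      fix i assume "Suc i < m"
      then show "r ((y(k := z)) i) < l ((y(k := z)) (Suc i))"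
        using y(2)[of i] z(3,4) by (cases "i = k"; cases "Suc i = k") auto
    next
      fix i assume "i < Suc k"
      then show "G u ((y(k := z)) i)" using y(3) z(2) by (cases "i = k") auto
    qed (use y(1) z(1) G_meet[OF u z(1,2)] in auto)
    then show ?case by blast
  qed
  then obtain y where "leaves m y" by blast
  then have y: "\<And>i. i < m \<Longrightarrow> y i \<in> V" "\<And>i. Suc i < m \<Longrightarrow> r (y i) < l (y (Suc i))" "\<And>i. i < m \<Longrightarrow> G u (y i)"
    unfolding leaves_def by auto
  have chain: "r (y i) < l (y j)" if "i < j" "j < m" for i j
    using that
  proof (induction j)
    case (Suc j)
    show ?case
    proof (cases "i = j")
      case True
      then show ?thesis using y(2) Suc by simp
    next
      case False
      then have "r (y i) < l (y j)" using Suc by simp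
      also have "\<dots> \<le> r (y j)" using le y(1) Suc by simp
      also have "\<dots> < l (y (Suc j))" using y(2) Suc by simp
      finally show ?thesis .
    qed
  qed simp
  have inj: "inj_on y {..<m}"
  proof (rule linorder_inj_onI)
    fix i j assume "i < j" "i \<in> {..<m}" "j \<in> {..<m}"
    then show "y i \<noteq> y j" using chain[of i j] le[OF y(1)[of i]] by auto
  qed auto
  have nadj: "\<not> G (y i) (y j)" if "i < m" "j < m" for i j
  proof -
    consider "i = j" | "i < j" | "j < i" by linarith
    then show ?thesis
    proof cases
      case 1
      then show ?thesis using irrG by (simp add: irreflp_def)
    next
      case 2
      then show ?thesis using chain[of i j] that G_meet(2)[OF y(1)[of i] y(1)[of j]] by force
    next
      case 3
      then show ?thesis using chain[of j i] that G_meet(1)[OF y(1)[of i] y(1)[of j]] by force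
    qed
  qed
  show ?thesis
  proof (intro exI[of _ "y ` {..<m}"] conjI)
    show "card (y ` {..<m}) = m" using card_image[OF inj] by simp
  qed (use y nadj in auto)
qed

end

section \<open>Cubicity of interval graphs\<close>

text \<open>Two local properties replace the maximum over chains. Intervals are added by increasing
  left end; the new one lies to the left of no other, so old heights persist.\<close>

lemma ex_height:
  fixes l r :: "'a \<Rightarrow> real"
  assumes "finite V" "\<And>v. v \<in> V \<Longrightarrow> l v \<le> r v"
  shows "\<exists>h::'a \<Rightarrow> nat. \<forall>v\<in>V. (\<forall>u\<in>V. r u < l v \<longrightarrow> h u < h v) \<and>
    (\<forall>k. h v = Suc k \<longrightarrow> (\<exists>p\<in>V. r p < l v \<and> h p = k))"
  using assms
proof (induction V rule: finite_ranking_induct[where f = l])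
  case empty
  then show ?case by simp
next
  case (insert x S)
  show ?case
  proof (cases "x \<in> S")
    case True
    then show ?thesis using insert by (simp add: insert_absorb)
  next
    case False
    obtain h :: "'a \<Rightarrow> nat" where "\<forall>v\<in>S. (\<forall>u\<in>S. r u < l v \<longrightarrow> h u < h v) \<and>
        (\<forall>k. h v = Suc k \<longrightarrow> (\<exists>p\<in>S. r p < l v \<and> h p = k))"
      using insert.IH[OF insert.prems[OF insertI2]] by blast
    then have h: "\<And>v u. v \<in> S \<Longrightarrow> u \<in> S \<Longrightarrow> r u < l v \<Longrightarrow> h u < h v"
      "\<And>v k. v \<in> S \<Longrightarrow> h v = Suc k \<Longrightarrow> \<exists>p\<in>S. r p < l v \<and> h p = k"
      by auto
    define P where "P = {u\<in>S. r u < l x}"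
    have finP: "finite P" unfolding P_def using insert by simp
    define n where "n = (if P = {} then 0 else Suc (Max (h ` P)))"
    have notx: "\<not> r x < l v" if "v \<in> insert x S" for v
      using insert.prems[of x] insert.hyps(2)[of v] that by fastforce
    have below: "h u < n" if "u \<in> S" "r u < l x" for u
    proof -
      have "u \<in> P" using that unfolding P_def by simp
      then show ?thesis unfolding n_def using finP by (auto intro: le_imp_less_Suc)
    qed
    have pred: "\<exists>p\<in>S. r p < l x \<and> h p = k" if "n = Suc k" for k
    proof -
      have "P \<noteq> {}" "k = Max (h ` P)" using that unfolding n_def by (auto split: if_splits)
      then have "k \<in> h ` P" using finP by simp
      then show ?thesis unfolding P_def by auto
    qed
    show ?thesis
    proof (intro exI[of _ "h(x := n)"] ballI conjI allI impI)
      fix v u assume "v \<in> insert x S" "u \<in> insert x S" "r u < l v"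
      then show "(h(x := n)) u < (h(x := n)) v"
        using notx[of v] h(1)[of v u] below[of u] by (cases "u = x"; cases "v = x") auto
    next
      fix v k assume v: "v \<in> insert x S" "(h(x := n)) v = Suc k"
      show "\<exists>p\<in>insert x S. r p < l v \<and> (h(x := n)) p = k"
      proof (cases "v = x")
        case True
        then obtain p where "p \<in> S" "r p < l v" "h p = k" using pred v by auto
        then show ?thesis using False by (intro bexI[of _ p]) auto
      next
        case vx: False
        then obtain p where "p \<in> S" "r p < l v" "h p = k" using h(2)[of v k] v by auto
        then show ?thesis using False by (intro bexI[of _ p]) auto
      qed
    qed
  qed
qed

text \<open>Going back from \<open>v\<close> along predecessors lowers the height by one each time.
  In \<open>d\<close> steps it does not fall below \<open>h u\<close>, so none of these intervals
  lies to the left of \<open>u\<close>; hence \<open>d + 1\<close> disjoint intervals meet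
  \<open>u\<close>.\<close>

lemma height_difference_claw:
  fixes l r :: "'a \<Rightarrow> real"
  assumes h: "\<forall>v\<in>V. (\<forall>u\<in>V. r u < l v \<longrightarrow> h u < h v) \<and> (\<forall>k. h v = Suc k \<longrightarrow> (\<exists>p\<in>V. r p < l v \<and> h p = k))"
    and le: "\<And>v. v \<in> V \<Longrightarrow> l v \<le> r v"
    and uv: "u \<in> V" "v \<in> V" "l u \<le> r v" "l v \<le> r u" "h v = h u + d"
  shows "\<exists>x. (\<forall>i<Suc d. x i \<in> V \<and> l u \<le> r (x i) \<and> l (x i) \<le> r u) \<and>
    (\<forall>i. Suc i < Suc d \<longrightarrow> r (x i) < l (x (Suc i))) \<and> x d = v"
  using uv(2-5)
proof (induction d arbitrary: v)
  case 0
  then show ?case by (intro exI[of _ "\<lambda>_. v"]) auto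
next
  case (Suc d)
  then obtain p where p: "p \<in> V" "r p < l v" "h p = h u + d" using h by force
  have "\<not> r p < l u" using h p uv(1) by force
  moreover have "l p \<le> r u" using le[OF p(1)] p(2) Suc.prems(3) by linarith
  ultimately obtain x where x: "\<forall>i<Suc d. x i \<in> V \<and> l u \<le> r (x i) \<and> l (x i) \<le> r u"
    "\<forall>i. Suc i < Suc d \<longrightarrow> r (x i) < l (x (Suc i))" "x d = p"
    using Suc.IH[OF p(1) _ _ p(3)] by auto
  show ?case
  proof (intro exI[of _ "x(Suc d := v)"] conjI allI impI)
    fix i assume "Suc i < Suc (Suc d)"
    then show "r ((x(Suc d := v)) i) < l ((x(Suc d := v)) (Suc i))"
      using x p by (cases "i = d") auto
  qed (use x Suc.prems less_Suc_eq in auto)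
qed

text \<open>The direction matters: the interval on the left must get digit 0 and the other digit 1.
  This happens at the highest digit where \<open>a\<close> and \<open>b\<close> differ.\<close>

lemma ex_bit_less:
  fixes a b :: nat
  assumes "a < b" "b < 2 ^ t"
  shows "\<exists>j<t. even (a div 2 ^ j) \<and> odd (b div 2 ^ j)"
  using assms
proof (induction t arbitrary: a b)
  case 0
  then show ?case by simp
next
  case (Suc t)
  show ?case
  proof (cases "a div 2 < b div 2")
    case True
    have "b div 2 < 2 ^ t" using Suc.prems(2) by auto
    then obtain j where "j < t" "even (a div 2 div 2 ^ j)" "odd (b div 2 div 2 ^ j)"
      using Suc.IH[OF True] by blast
    then show ?thesis
      by (intro exI[of _ "Suc j"]) (simp add: div_mult2_eq)
  next
    case False
    then have "even a" "odd b" using Suc.prems(1) by presburger+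
    then show ?thesis by (intro exI[of _ 0]) simp
  qed
qed

text \<open>The sign pattern \<open>s\<close> is arbitrary: intersecting intervals are never pushed apart.\<close>

lemma unit_signs:
  fixes l r :: "'a \<Rightarrow> real"
  assumes "\<bar>l u\<bar> \<le> 1/8" "\<bar>r u\<bar> \<le> 1/8" "\<bar>l v\<bar> \<le> 1/8" "\<bar>r v\<bar> \<le> 1/8"
  defines "f \<equiv> \<lambda>s v. if s v then 1/2 + l v else - 1/2 + r v"
  shows "l u \<le> r v \<Longrightarrow> l v \<le> r u \<Longrightarrow> \<bar>f s u - f s v\<bar> \<le> 1"
    and "r u < l v \<Longrightarrow> \<not> s u \<Longrightarrow> s v \<Longrightarrow> 1 < \<bar>f s u - f s v\<bar>"
  using assms(1-4) unfolding f_def by (cases "s u"; cases "s v"; simp only: if_True if_False; linarith)+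

text \<open>Consecutive blocks \<open>q\<close> lie at distance 1 after an even block and at distance 1/2 after
  an odd one.\<close>

lemma unit_blocks:
  fixes l r :: "'a \<Rightarrow> real" and q :: "'a \<Rightarrow> nat"
  assumes b: "\<bar>l u\<bar> \<le> 1/8" "\<bar>r u\<bar> \<le> 1/8" "\<bar>l v\<bar> \<le> 1/8" "\<bar>r v\<bar> \<le> 1/8"
  defines "f \<equiv> \<lambda>v. real (q v div 2) * (3/2) + (if odd (q v) then 1 + l v else r v)"
  shows "l u \<le> r v \<Longrightarrow> l v \<le> r u \<Longrightarrow> q v = q u \<or> q v = Suc (q u) \<Longrightarrow> \<bar>f u - f v\<bar> \<le> 1"
    and "r u < l v \<Longrightarrow> even (q u) \<and> q v = Suc (q u) \<or> Suc (q u) < q v \<Longrightarrow> 1 < \<bar>f u - f v\<bar>"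
proof -
  assume uv: "l u \<le> r v" "l v \<le> r u" "q v = q u \<or> q v = Suc (q u)"
  consider "q v = q u" "even (q u)" | "q v = q u" "odd (q u)"
    | "q v = Suc (q u)" "even (q u)" | "q v = Suc (q u)" "odd (q u)"
    using uv(3) by blast
  then show "\<bar>f u - f v\<bar> \<le> 1"
  proof cases
    case 1
    then have "f u - f v = r u - r v" by (simp add: f_def)
    then show ?thesis using b by linarith
  next
    case 2
    then have "f u - f v = l u - l v" by (simp add: f_def)
    then show ?thesis using b by linarith
  next
    case 3
    then have "f u - f v = r u - l v - 1" by (simp add: f_def)
    then show ?thesis using b uv by linarith
  next
    case 4
    then have "f u - f v = l u - r v - 1/2" by (simp add: f_def algebra_simps)
    then show ?thesis using b by linarith
  qed
next
  assume uv: "r u < l v" "even (q u) \<and> q v = Suc (q u) \<or> Suc (q u) < q v"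
  show "1 < \<bar>f u - f v\<bar>"
  proof (cases "Suc (q u) < q v")
    case False
    then have q: "even (q u)" "q v = Suc (q u)" "Suc (q u) div 2 = q u div 2" using uv(2) by auto
    then have "f u - f v = r u - l v - 1" by (simp add: f_def)
    then show ?thesis using uv(1) by linarith
  next
    case True
    \<comment> \<open>\<open>e\<close> is the position without the small endpoints. Blocks at
      distance at least two are at least one period of \<open>3/2\<close> apart, which leaves room
      for two errors of \<open>1/8\<close>.\<close>
    define e where "e v = real (q v div 2) * (3/2) + (if odd (q v) then 1 else 0)" for v
    have "e u + 3/2 \<le> e v"
    proof -
      have "q u div 2 + 2 \<le> q v div 2 \<or> q v div 2 = q u div 2 + 1 \<and> (odd (q u) \<longrightarrow> odd (q v))"
        using True by presburger
      then show ?thesis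
      proof
        assume "q u div 2 + 2 \<le> q v div 2"
        then have "real (q u div 2) + 2 \<le> real (q v div 2)" by linarith
        then show ?thesis unfolding e_def by auto
      next
        assume "q v div 2 = q u div 2 + 1 \<and> (odd (q u) \<longrightarrow> odd (q v))"
        then show ?thesis unfolding e_def by (auto simp: algebra_simps)
      qed
    qed
    moreover have "\<bar>f u - e u\<bar> \<le> 1/8" "\<bar>f v - e v\<bar> \<le> 1/8" using b unfolding f_def e_def by auto
    ultimately show ?thesis by linarith
  qed
qed

text \<open>Only the order of the endpoints counts, so they can be shrunk to perturbations. Two
  errors of \<open>1/8\<close> stay below \<open>1/2\<close>, the slack in the coordinates.\<close>

lemma interval_rep_scaled:
  assumes fin: "finite V" and rep: "interval_rep V H l r"
  obtains l' r' where "interval_rep V H l' r'" "\<And>v. v \<in> V \<Longrightarrow> \<bar>l' v\<bar> \<le> 1/8 \<and> \<bar>r' v\<bar> \<le> 1/8"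
    "\<And>u v. l' u \<le> r' v \<longleftrightarrow> l u \<le> r v"
proof -
  define B where "B = (\<Sum>z\<in>V. \<bar>l z\<bar> + \<bar>r z\<bar>) + 1"
  have "\<bar>l z\<bar> + \<bar>r z\<bar> \<le> (\<Sum>z\<in>V. \<bar>l z\<bar> + \<bar>r z\<bar>)" if "z \<in> V" for z
    using that fin by (intro member_le_sum) auto
  then have B: "\<bar>l z\<bar> \<le> B" "\<bar>r z\<bar> \<le> B" if "z \<in> V" for z
    using that unfolding B_def by (smt (verit))+
  have B0: "0 < B" unfolding B_def by (smt (verit) sum_nonneg abs_ge_zero)
  have iff: "x / (8 * B) \<le> y / (8 * B) \<longleftrightarrow> x \<le> y" for x y
    using B0 by (simp add: divide_le_cancel)
  show ?thesis
  proof (rule that[of "\<lambda>v. l v / (8 * B)" "\<lambda>v. r v / (8 * B)"])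
    show "interval_rep V H (\<lambda>v. l v / (8 * B)) (\<lambda>v. r v / (8 * B))"
      using rep unfolding interval_rep_def iff .
    show "\<bar>l v / (8 * B)\<bar> \<le> 1/8 \<and> \<bar>r v / (8 * B)\<bar> \<le> 1/8" if "v \<in> V" for v
      using B[OF that] B0 by (auto simp: abs_mult divide_simps)
  qed (rule iff)
qed

text \<open>By \<open>adj\<close>, intersecting intervals lie in equal or consecutive blocks
  \<open>h v div 2 ^ t\<close>, which suffices for \<open>unit_blocks\<close> to keep them close. A
  block coordinate separates consecutive blocks only if the lower one is even; the shift
  \<open>c\<close> adjusts the parity.\<close>

lemma interval_graph_unit_functions:
  fixes h :: "'a \<Rightarrow> nat"
  assumes fin: "finite V" and rep0: "interval_rep V H l0 r0"
    and h: "\<And>u v. u \<in> V \<Longrightarrow> v \<in> V \<Longrightarrow> r0 u < l0 v \<Longrightarrow> h u < h v"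
    and adj: "\<And>u v. u \<in> V \<Longrightarrow> v \<in> V \<Longrightarrow> l0 u \<le> r0 v \<Longrightarrow> l0 v \<le> r0 u \<Longrightarrow> h v \<le> h u + 2 ^ t"
  shows "\<exists>f :: nat \<Rightarrow> 'a \<Rightarrow> real. \<forall>u\<in>V. \<forall>v\<in>V. u \<noteq> v \<longrightarrow> (H u v \<longleftrightarrow> (\<forall>j<t + 2. \<bar>f j u - f j v\<bar> \<le> 1))"
proof -
  obtain l r where rep: "interval_rep V H l r" and b: "\<And>v. v \<in> V \<Longrightarrow> \<bar>l v\<bar> \<le> 1/8 \<and> \<bar>r v\<bar> \<le> 1/8"
    and iff: "\<And>u v. l u \<le> r v \<longleftrightarrow> l0 u \<le> r0 v"
    using interval_rep_scaled[OF fin rep0] by metis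
  have h': "h u < h v" if "u \<in> V" "v \<in> V" "r u < l v" for u v
    using h[OF that(1,2)] that(3) iff[of v u] by linarith
  have adj': "h v \<le> h u + 2 ^ t" if "u \<in> V" "v \<in> V" "l u \<le> r v" "l v \<le> r u" for u v
    using adj[OF that(1,2)] that(3,4) iff by blast
  define q where "q c v = h v div 2 ^ t + c" for c v
  \<comment> \<open>With digit 0 at \<open>u\<close> and digit 1 at \<open>v\<close> the values
    differ by \<open>1 + l v - r u\<close>, which exceeds 1 exactly when \<open>u\<close> ends
    before \<open>v\<close> starts.\<close>
  define F where "F j v = (if odd (h v mod 2 ^ t div 2 ^ j) then 1/2 + l v else - 1/2 + r v)" for j v
  \<comment> \<open>From an even block to the next the values again differ by
    \<open>1 + l v - r u\<close>. After an odd block they differ by \<open>1/2 + r v - l u\<close>;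
    with 1 in place of \<open>1/2\<close>, intersecting intervals could be pushed apart.\<close>
  define Q where "Q c v = real (q c v div 2) * (3/2) + (if odd (q c v) then 1 + l v else r v)" for c v
  define f where "f j = (if j < t then F j else Q (j - t))" for j
  have F1: "\<bar>F j u - F j v\<bar> \<le> 1" if "u \<in> V" "v \<in> V" "l u \<le> r v" "l v \<le> r u" for j u v
    unfolding F_def
    by (rule unit_signs(1)) (use b[OF that(1)] b[OF that(2)] that(3,4) in auto)
  have F2: "1 < \<bar>F j u - F j v\<bar>"
    if "u \<in> V" "v \<in> V" "r u < l v" "even (h u mod 2 ^ t div 2 ^ j)" "odd (h v mod 2 ^ t div 2 ^ j)" for j u v
    unfolding F_def
    by (rule unit_signs(2)) (use b[OF that(1)] b[OF that(2)] that(3-5) in auto)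
  have Q1: "\<bar>Q c u - Q c v\<bar> \<le> 1" if "u \<in> V" "v \<in> V" "l u \<le> r v" "l v \<le> r u" "h u \<le> h v" for c u v
  proof -
    have "h v div 2 ^ t \<le> (h u + 2 ^ t) div 2 ^ t" using adj'[OF that(1-4)] by (rule div_le_mono)
    then have "h v div 2 ^ t \<le> Suc (h u div 2 ^ t)" by simp
    moreover have "h u div 2 ^ t \<le> h v div 2 ^ t" using that(5) by (rule div_le_mono)
    ultimately have "q c v = q c u \<or> q c v = Suc (q c u)" unfolding q_def by linarith
    then show ?thesis
      unfolding Q_def
      by (intro unit_blocks(1)) (use b[OF that(1)] b[OF that(2)] that(3,4) in auto)
  qed
  have Q2: "1 < \<bar>Q c u - Q c v\<bar>"
    if "u \<in> V" "v \<in> V" "r u < l v" "even (q c u) \<and> q c v = Suc (q c u) \<or> Suc (q c u) < q c v" for c u v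
    unfolding Q_def
    by (rule unit_blocks(2)) (use b[OF that(1)] b[OF that(2)] that(3,4) in auto)
  have close: "\<bar>f j u - f j v\<bar> \<le> 1" if "u \<in> V" "v \<in> V" "l u \<le> r v" "l v \<le> r u" for j u v
  proof (cases "j < t")
    case True
    then show ?thesis using F1[OF that] by (simp add: f_def)
  next
    case False
    then show ?thesis
      using Q1[OF that, of "j - t"] Q1[OF that(2,1,4,3), of "j - t"]
      by (cases "h u \<le> h v") (auto simp: f_def abs_minus_commute)
  qed
  have far: "\<exists>j<t + 2. 1 < \<bar>f j u - f j v\<bar>" if uv: "u \<in> V" "v \<in> V" "r u < l v" for u v
  proof -
    have lt: "h u < h v" using h'[OF uv] .
    show ?thesis
    proof (cases "h u div 2 ^ t = h v div 2 ^ t")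
      case True
      then have "h u mod 2 ^ t < h v mod 2 ^ t"
        using lt by (metis add_less_cancel_left div_mult_mod_eq)
      then obtain j where "j < t" "even (h u mod 2 ^ t div 2 ^ j)" "odd (h v mod 2 ^ t div 2 ^ j)"
        using ex_bit_less[of "h u mod 2 ^ t" "h v mod 2 ^ t" t] by auto
      then show ?thesis using F2[OF uv] by (intro exI[of _ j]) (simp add: f_def)
    next
      case False
      moreover have "h u div 2 ^ t \<le> h v div 2 ^ t" using lt by (intro div_le_mono) simp
      ultimately have less: "h u div 2 ^ t < h v div 2 ^ t" by simp
      define c where "c = (if even (h u div 2 ^ t) then 0 else 1 :: nat)"
      have "even (q c u)" "q c u < q c v" using less by (auto simp: q_def c_def)
      then have "even (q c u) \<and> q c v = Suc (q c u) \<or> Suc (q c u) < q c v" by linarith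
      then have "1 < \<bar>Q c u - Q c v\<bar>" using Q2[OF uv] by blast
      then show ?thesis by (intro exI[of _ "t + c"]) (auto simp: f_def c_def)
    qed
  qed
  show ?thesis
  proof (intro exI[of _ f] ballI impI)
    fix u v assume uv: "u \<in> V" "v \<in> V" "u \<noteq> v"
    have "H u v \<longleftrightarrow> l u \<le> r v \<and> l v \<le> r u" using rep uv by (rule interval_rep_adj)
    moreover have "(\<forall>j<t + 2. \<bar>f j u - f j v\<bar> \<le> 1) \<longleftrightarrow> l u \<le> r v \<and> l v \<le> r u"
      using close[OF uv(1,2)] far[OF uv(1,2)] far[OF uv(2,1)]
      by (metis abs_minus_commute linorder_not_less)
    ultimately show "H u v \<longleftrightarrow> (\<forall>j<t + 2. \<bar>f j u - f j v\<bar> \<le> 1)" by simp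
  qed
qed

section \<open>AT-free graphs\<close>

lemma at_free_interval_between:
  assumes fin: "finite V" and G: "symp G" "irreflp G" "at_free V G"
    and J: "symp J" "irreflp J" "chordal V J" and GJ: "\<And>u v. G u v \<Longrightarrow> J u v"
  obtains H l r where "interval_fill V G H l r" "\<And>u v. H u v \<Longrightarrow> J u v"
proof -
  obtain H where H: "symp H" "irreflp H" "chordal V H" "min_fill V G H"
    "\<And>u v. G u v \<Longrightarrow> H u v" "\<And>u v. H u v \<Longrightarrow> J u v"
    using ex_minimal_triangulation[OF fin G(1,2) J GJ] by blast
  have "at_free V H" using min_fill_at_free[OF G(1) H(1-5) G(3)] .
  then obtain l r where "interval_rep V H l r"
    using chordal_at_free_interval[OF fin H(1-3)] unfolding interval_graph_def by blast
  then have "interval_fill V G H l r" using G H by unfold_locales auto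
  then show ?thesis using that H(6) by blast
qed

text \<open>A height gap \<open>d > 0\<close> between intersecting intervals yields a claw of
  \<open>G\<close> with \<open>d + 1\<close> leaves, so \<open>d < 2 ^ t\<close>.\<close>

lemma at_free_unit_functions:
  assumes fin: "finite V" and G: "symp G" "irreflp G" "at_free V G"
    and J: "symp J" "irreflp J" "chordal V J" and GJ: "\<And>u v. G u v \<Longrightarrow> J u v"
    and claw: "\<And>u S. u \<in> V \<Longrightarrow> S \<subseteq> V \<Longrightarrow> S \<noteq> {} \<Longrightarrow> \<forall>s\<in>S. G u s \<Longrightarrow> \<forall>s\<in>S. \<forall>t\<in>S. \<not> G s t \<Longrightarrow> card S \<le> 2 ^ t"
  shows "\<exists>f :: nat \<Rightarrow> 'a \<Rightarrow> real. \<forall>u\<in>V. \<forall>v\<in>V. u \<noteq> v \<longrightarrow>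
    (G u v \<longrightarrow> (\<forall>j<t + 2. \<bar>f j u - f j v\<bar> \<le> 1)) \<and> ((\<forall>j<t + 2. \<bar>f j u - f j v\<bar> \<le> 1) \<longrightarrow> J u v)"
proof -
  obtain H l r where fill: "interval_fill V G H l r" and HJ: "\<And>u v. H u v \<Longrightarrow> J u v"
    using at_free_interval_between[OF fin G J GJ] by metis
  interpret interval_fill V G H l r by (rule fill)
  obtain h :: "'a \<Rightarrow> nat" where h: "\<forall>v\<in>V. (\<forall>u\<in>V. r u < l v \<longrightarrow> h u < h v) \<and>
    (\<forall>k. h v = Suc k \<longrightarrow> (\<exists>p\<in>V. r p < l v \<and> h p = k))"
    using ex_height[OF fin, of l r] le by blast
  have adj: "h v \<le> h u + 2 ^ t" if uv: "u \<in> V" "v \<in> V" "l u \<le> r v" "l v \<le> r u" for u v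
  proof (cases "h v \<le> h u")
    case False
    then obtain d where d: "h v = h u + d" "0 < d" by (metis less_imp_add_positive not_le)
    obtain x where "\<forall>i<Suc d. x i \<in> V \<and> l u \<le> r (x i) \<and> l (x i) \<le> r u"
      "\<forall>i. Suc i < Suc d \<longrightarrow> r (x i) < l (x (Suc i))"
      using height_difference_claw[OF h le uv d(1)] by blast
    then obtain S where S: "S \<subseteq> V" "card S = Suc d" "\<forall>s\<in>S. G u s" "\<forall>s\<in>S. \<forall>t\<in>S. \<not> G s t"
      using claw_transfer[OF G(3) uv(1), of "Suc d" x] d(2) by auto
    then have "S \<noteq> {}" by auto
    then have "Suc d \<le> 2 ^ t" using claw[OF uv(1) S(1) _ S(3,4)] S(2) by simp
    then show ?thesis using d(1) by simp
  qed simp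
  obtain f :: "nat \<Rightarrow> 'a \<Rightarrow> real" where
    f: "\<forall>u\<in>V. \<forall>v\<in>V. u \<noteq> v \<longrightarrow> (H u v \<longleftrightarrow> (\<forall>j<t + 2. \<bar>f j u - f j v\<bar> \<le> 1))"
    using interval_graph_unit_functions[OF fin rep, of h t] h adj by blast
  show ?thesis
    by (intro exI[of _ f]) (use f GH HJ in blast)
qed

text \<open>Vertices \<open>u\<close>, \<open>v\<close> that are non-adjacent in \<open>G\<close>
  stay so in \<open>J (c u)\<close>, where all edges at the colour class of \<open>u\<close> come
  from \<open>G\<close>.\<close>

lemma at_free_colouring_interval_graphs:
  fixes c :: "'a \<Rightarrow> nat"
  assumes fin: "finite V" and G: "symp G" "irreflp G" "at_free V G"
    and c: "\<And>v. v \<in> V \<Longrightarrow> c v < k" "\<And>u v. G u v \<Longrightarrow> c u \<noteq> c v"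
  shows "\<exists>l r :: nat \<Rightarrow> 'a \<Rightarrow> real. (\<forall>i. \<forall>v\<in>V. l i v \<le> r i v) \<and>
    (\<forall>u\<in>V. \<forall>v\<in>V. u \<noteq> v \<longrightarrow> (G u v \<longleftrightarrow> (\<forall>i<k. l i u \<le> r i v \<and> l i v \<le> r i u)))"
proof -
  define J where "J i u v \<longleftrightarrow> G u v \<or> u \<noteq> v \<and> c u \<noteq> i \<and> c v \<noteq> i" for i u v
  define P where "P i l r \<longleftrightarrow> (\<forall>v\<in>V. l v \<le> r v) \<and> (\<forall>u\<in>V. \<forall>v\<in>V. u \<noteq> v \<longrightarrow>
      (G u v \<longrightarrow> l u \<le> r v \<and> l v \<le> r u) \<and> (l u \<le> r v \<and> l v \<le> r u \<longrightarrow> J i u v))"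
    for i and l r :: "'a \<Rightarrow> real"
  have "\<exists>l r. P i l r" for i
  proof -
    have sym: "symp (J i)" using G(1) by (auto simp: symp_def J_def)
    have irr: "irreflp (J i)" using G(2) by (auto simp: irreflp_def J_def)
    \<comment> \<open>The neighbours of a vertex of colour \<open>i\<close> lie in the clique of the
      other colours, so they form a clique that cuts off this vertex.\<close>
    have star: "separated V (J i) u v" if "u \<in> V" "v \<in> V" "u \<noteq> v" "\<not> J i u v" "c u = i" for u v
    proof (rule separatedI[of "{u}" V "{w\<in>V. J i u w}"])
      show "clique (J i) {w\<in>V. J i u w}"
      proof -
        have "c w \<noteq> i" if "J i u w" for w
          using that c(2)[of u w] \<open>c u = i\<close> unfolding J_def by auto
        then show ?thesis unfolding clique_def J_def by blast
      qed
    qed (use that irr in \<open>auto simp: irreflp_def\<close>)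
    have "chordal V (J i)"
      unfolding chordal_def
    proof (intro ballI impI)
      fix u v assume uv: "u \<in> V" "v \<in> V" "u \<noteq> v \<and> \<not> J i u v"
      then have "\<not> J i v u" "c u = i \<or> c v = i" using sym by (auto simp: J_def dest: sympD)
      then show "separated V (J i) u v"
        using star[of u v] separated_sym[OF sym star[of v u]] uv by blast
    qed
    then obtain H l r where fill: "interval_fill V G H l r" and HJ: "\<And>u v. H u v \<Longrightarrow> J i u v"
      using at_free_interval_between[OF fin G sym irr] unfolding J_def by metis
    interpret interval_fill V G H l r by (rule fill)
    show ?thesis
      unfolding P_def by (rule exI[of _ l], rule exI[of _ r]) (use le G_meet adjI HJ in blast)
  qed
  then obtain l r where "\<And>i. P i (l i) (r i)" by metis
  then have lr: "\<And>i v. v \<in> V \<Longrightarrow> l i v \<le> r i v"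
    "\<And>i u v. u \<in> V \<Longrightarrow> v \<in> V \<Longrightarrow> u \<noteq> v \<Longrightarrow> G u v \<Longrightarrow> l i u \<le> r i v \<and> l i v \<le> r i u"
    "\<And>i u v. u \<in> V \<Longrightarrow> v \<in> V \<Longrightarrow> u \<noteq> v \<Longrightarrow> l i u \<le> r i v \<and> l i v \<le> r i u \<Longrightarrow> J i u v"
    unfolding P_def by blast+
  have GI: "G u v" if "u \<in> V" "v \<in> V" "u \<noteq> v" "\<forall>i<k. l i u \<le> r i v \<and> l i v \<le> r i u" for u v
    using lr(3)[OF that(1-3), of "c u"] that(4) c(1)[OF that(1)] unfolding J_def by blast
  show ?thesis
    by (rule exI[of _ l], rule exI[of _ r]) (use lr GI in blast)
qed

lemma PiE_box_inter_nonempty: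
  fixes a b a' b' :: "nat \<Rightarrow> real"
  assumes "\<forall>i<k. a i \<le> b i" "\<forall>i<k. a' i \<le> b' i"
  shows "(\<Pi>\<^sub>E i\<in>{..<k}. {a i..b i}) \<inter> (\<Pi>\<^sub>E i\<in>{..<k}. {a' i..b' i}) \<noteq> {} \<longleftrightarrow>
    (\<forall>i<k. a i \<le> b' i \<and> a' i \<le> b i)"
proof -
  have "{a i..b i} \<inter> {a' i..b' i} \<noteq> {} \<longleftrightarrow> a i \<le> b' i \<and> a' i \<le> b i" if "i < k" for i
    using assms that by auto
  then show ?thesis
    unfolding PiE_Int PiE_eq_empty_iff by blast
qed

section \<open>Transfer to the notions of the graph library\<close>

context graph
begin

lemma symp_dominates: "symp (dominates G)"
  using graph_symmetric by (auto simp: symp_def)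

lemma irreflp_dominates: "irreflp (dominates G)"
  using adj_not_same by (auto simp: irreflp_def)

lemma conn_imp_vpath:
  assumes "conn (dominates G) X x y" "X \<subseteq> verts G" "x \<in> X"
  obtains p where "vpath p G" "hd p = x" "last p = y" "set p \<subseteq> X"
proof -
  have "\<exists>p. vwalk p G \<and> hd p = x \<and> last p = y \<and> set p \<subseteq> X"
    using assms(1,3) unfolding conn_def
  proof (induction rule: converse_rtranclp_induct)
    case base
    then show ?case using assms(2) by (intro exI[of _ "[y]"]) auto
  next
    case (step a b)
    then obtain p where p: "vwalk p G" "hd p = b" "last p = y" "set p \<subseteq> X" by auto
    then have "p \<noteq> []" by auto
    then show ?case
      using p step by (intro exI[of _ "a # p"]) (auto intro!: vwalk_wf_digraph_consI)
  qed
  then obtain p where p: "vwalk p G" "hd p = x" "last p = y" "set p \<subseteq> X" by blast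
  show ?thesis
  proof (rule that[of "vwalk_to_vpath p"])
    show "set (vwalk_to_vpath p) \<subseteq> X" using p(4) vwalk_to_vpath_subset by fastforce
  qed (use p in \<open>auto simp: vwalk_to_vpath_hd vwalk_to_vpath_last intro: vwalk_to_vpath_vpath\<close>)
qed

text \<open>Three connections become six by symmetry. That each path starts outside the
  neighbourhood of the third vertex follows from independence, not from \<open>conn\<close>, which
  is reflexive everywhere.\<close>

lemma AT_free_imp_at_free:
  assumes "AT_free G"
  shows "at_free (verts G) (dominates G)"
  unfolding at_free_def
proof (rule notI, elim bexE conjE)
  fix x y z
  let ?X = "\<lambda>w. {v \<in> verts G. \<not> w \<rightarrow>\<^bsub>G\<^esub> v}"
  assume V: "x \<in> verts G" "y \<in> verts G" "z \<in> verts G" and d: "x \<noteq> y" "x \<noteq> z" "y \<noteq> z"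
    and n: "\<not> x \<rightarrow>\<^bsub>G\<^esub> y" "\<not> x \<rightarrow>\<^bsub>G\<^esub> z" "\<not> y \<rightarrow>\<^bsub>G\<^esub> z"
    and c: "conn (dominates G) (?X z) x y" "conn (dominates G) (?X y) x z" "conn (dominates G) (?X x) y z"
  have n': "\<not> y \<rightarrow>\<^bsub>G\<^esub> x" "\<not> z \<rightarrow>\<^bsub>G\<^esub> x" "\<not> z \<rightarrow>\<^bsub>G\<^esub> y"
    using n graph_symmetric by blast+
  have c': "conn (dominates G) (?X z) y x" "conn (dominates G) (?X y) z x" "conn (dominates G) (?X x) z y"
    using c conn_sym[OF symp_dominates] by blast+
  have path: "\<exists>p. vpath p G \<and> hd p = u \<and> last p = v \<and> set p \<inter> neighbourhood G w = {}"
    if w: "u \<in> verts G" "\<not> w \<rightarrow>\<^bsub>G\<^esub> u" "conn (dominates G) (?X w) u v" for u v w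
  proof -
    obtain p where "vpath p G" "hd p = u" "last p = v" "set p \<subseteq> ?X w"
      using conn_imp_vpath[OF w(3)] w(1,2) by auto
    then show ?thesis unfolding neighbourhood_def by (intro exI[of _ p]) auto
  qed
  have "asteroidal_triple G {x, y, z}"
    unfolding asteroidal_triple_def independent_set_def
  proof (intro conjI ballI impI)
    show "card {x, y, z} = 3" using d by simp
    show "{x, y, z} \<subseteq> verts G" using V by simp
    show "\<not> u \<rightarrow>\<^bsub>G\<^esub> v" if "u \<in> {x, y, z}" "v \<in> {x, y, z}" for u v
      using that n n' adj_not_same by auto
    show "\<exists>p. vpath p G \<and> hd p = u \<and> last p = v \<and> set p \<inter> neighbourhood G w = {}"
      if "u \<in> {x, y, z}" "v \<in> {x, y, z}" "w \<in> {x, y, z}" "u \<noteq> v \<and> u \<noteq> w \<and> v \<noteq> w" for u v w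
    proof (rule path)
      show "conn (dominates G) (?X w) u v" using that c c' by (elim insertE emptyE) simp_all
      show "u \<in> verts G" "\<not> w \<rightarrow>\<^bsub>G\<^esub> u" using that V n n' by auto
    qed
  qed
  then show False using assms unfolding AT_free_def by blast
qed

text \<open>\<open>insert u S\<close> induces a star. Boundedness must be shown as well, since
  \<open>Sup\<close> is known to be an upper bound only for a bounded set.\<close>

lemma claw_le_claw_number:
  assumes u: "u \<in> verts G" and S: "S \<subseteq> verts G" "S \<noteq> {}" "\<forall>s\<in>S. u \<rightarrow>\<^bsub>G\<^esub> s" "\<forall>s\<in>S. \<forall>t\<in>S. \<not> s \<rightarrow>\<^bsub>G\<^esub> t"
  shows "card S \<le> claw_number G"
  unfolding claw_number_def
proof (rule cSup_upper)
  let ?H = "G \<restriction> insert u S"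
  have finS: "finite S" using S(1) finite_verts by (rule finite_subset)
  have ind: "induced_subgraph ?H G" using u S(1) by (intro induced_induce) auto
  have graphH: "graph ?H"
    using digraph.graphI[OF digraphI_induced[OF ind]] induced_graph_imp_symmetric[OF sym_arcs ind] by blast
  have uS: "u \<notin> S" using S(3) adj_not_same by blast
  have "arcs_ends ?H = {(a, b). a \<rightarrow>\<^bsub>G\<^esub> b \<and> a \<in> insert u S \<and> b \<in> insert u S}"
    unfolding arcs_ends_conv by auto
  also have "\<dots> = {u} \<times> S \<union> S \<times> {u}"
    using S(3,4) adj_not_same graph_symmetric by blast
  finally have ends: "arcs_ends ?H = {u} \<times> S \<union> S \<times> {u}" .
  have "K\<^bsub>1,card S\<^esub> ?H"
    unfolding complete_bipartite_digraph_def
    by (rule conjI[OF graphH], rule exI[of _ "{u}"], rule exI[of _ S]) (use uS ends in auto)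
  then show "card S \<in> {k. 0 < k \<and> (\<exists>H. induced_subgraph H G \<and> K\<^bsub>1,k\<^esub> H)}"
    using ind finS S(2) by (auto simp: card_gt_0_iff)
  show "bdd_above {k. 0 < k \<and> (\<exists>H. induced_subgraph H G \<and> K\<^bsub>1,k\<^esub> H)}"
  proof (rule bdd_aboveI[of _ "card (verts G)"], elim CollectE conjE exE)
    fix k H assume H: "induced_subgraph H G" "K\<^bsub>1,k\<^esub> H"
    obtain U W where "verts H = U \<union> W" "card W = k"
      using H(2) unfolding complete_bipartite_digraph_def by blast
    moreover have "verts H \<subseteq> verts G" using H(1) by auto
    ultimately show "k \<le> card (verts G)" using card_mono[OF finite_verts, of W] by auto
  qed
qed

end

text \<open>An injective colouring shows that the \<open>LEAST\<close> is attained.\<close>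

lemma ex_proper_colouring:
  assumes "graph G"
  obtains c where "c \<in> verts G \<rightarrow> {..<chromatic_number G}" "\<And>u v. u \<rightarrow>\<^bsub>G\<^esub> v \<Longrightarrow> c u \<noteq> c v"
proof -
  interpret graph G by (rule assms)
  obtain c :: "'a \<Rightarrow> nat" where c: "bij_betw c (verts G) {0..<card (verts G)}"
    using ex_bij_betw_finite_nat[OF finite_verts] by blast
  have "c \<in> verts G \<rightarrow> {..<card (verts G)}"
    using c by (auto simp: bij_betw_def)
  moreover have "c u \<noteq> c v" if "u \<rightarrow>\<^bsub>G\<^esub> v" for u v
    using that c adj_not_same adj_in_verts[OF that] unfolding bij_betw_def by (metis inj_onD)
  ultimately have "\<exists>c. c \<in> verts G \<rightarrow> {..<card (verts G)} \<and> (\<forall>u v. u \<rightarrow>\<^bsub>G\<^esub> v \<longrightarrow> c u \<noteq> c v)"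
    by blast
  then have "\<exists>c. c \<in> verts G \<rightarrow> {..<chromatic_number G} \<and> (\<forall>u v. u \<rightarrow>\<^bsub>G\<^esub> v \<longrightarrow> c u \<noteq> c v)"
    unfolding chromatic_number_def by (rule LeastI)
  then show ?thesis using that by blast
qed

definition box_rep :: "('a, 'b) pre_digraph \<Rightarrow> nat \<Rightarrow> bool" where
  "box_rep G k \<longleftrightarrow> (\<exists>f. (\<forall>v\<in>verts G. axis_parallel_box k (f v)) \<and> intersection_graph_of G f)"

lemma AT_free_box_rep_chromatic_number:
  fixes G :: "('a, 'b) pre_digraph"
  assumes "graph G" "AT_free G"
  shows "box_rep G (chromatic_number G)"
proof -
  interpret graph G by (rule assms(1))
  let ?k = "chromatic_number G"
  obtain c where c: "c \<in> verts G \<rightarrow> {..<?k}" "\<And>u v. u \<rightarrow>\<^bsub>G\<^esub> v \<Longrightarrow> c u \<noteq> c v"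
    using ex_proper_colouring[OF assms(1)] by blast
  have ck: "c v < ?k" if "v \<in> verts G" for v using c(1) that by auto
  obtain l r :: "nat \<Rightarrow> 'a \<Rightarrow> real" where lr: "\<forall>i. \<forall>v\<in>verts G. l i v \<le> r i v"
    "\<forall>u\<in>verts G. \<forall>v\<in>verts G. u \<noteq> v \<longrightarrow> (u \<rightarrow>\<^bsub>G\<^esub> v \<longleftrightarrow> (\<forall>i<?k. l i u \<le> r i v \<and> l i v \<le> r i u))"
  proof -
    have "\<exists>l r :: nat \<Rightarrow> 'a \<Rightarrow> real. (\<forall>i. \<forall>v\<in>verts G. l i v \<le> r i v) \<and>
      (\<forall>u\<in>verts G. \<forall>v\<in>verts G. u \<noteq> v \<longrightarrow> (u \<rightarrow>\<^bsub>G\<^esub> v \<longleftrightarrow> (\<forall>i<?k. l i u \<le> r i v \<and> l i v \<le> r i u)))"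
      by (rule at_free_colouring_interval_graphs[OF finite_verts symp_dominates irreflp_dominates
            AT_free_imp_at_free[OF assms(2)], of c]) (use ck c(2) in auto)
    then show ?thesis using that by (elim exE conjE)
  qed
  define f where "f v = (\<Pi>\<^sub>E i\<in>{..<?k}. {l i v..r i v})" for v
  have "axis_parallel_box ?k (f v)" if "v \<in> verts G" for v
    unfolding axis_parallel_box_def f_def
    by (rule exI[of _ "\<lambda>i. l i v"], rule exI[of _ "\<lambda>i. r i v"]) (use lr(1) that in auto)
  moreover have "intersection_graph_of G f"
    unfolding intersection_graph_of_def
  proof (intro ballI impI)
    fix u v assume uv: "u \<in> verts G" "v \<in> verts G" "u \<noteq> v"
    have "f u \<inter> f v \<noteq> {} \<longleftrightarrow> (\<forall>i<?k. l i u \<le> r i v \<and> l i v \<le> r i u)"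
      unfolding f_def by (rule PiE_box_inter_nonempty) (use lr(1) uv in auto)
    then show "u \<rightarrow>\<^bsub>G\<^esub> v \<longleftrightarrow> f u \<inter> f v \<noteq> {}"
      using lr(2) uv by blast
  qed
  ultimately show ?thesis unfolding box_rep_def by blast
qed

text \<open>Each box coordinate is an interval graph \<open>J i\<close> above \<open>G\<close> and
  yields \<open>t + 2\<close> functions. Vertices that are close in all of them are adjacent in
  every \<open>J i\<close>, hence in \<open>G\<close>. Unit cubes meet exactly when their lower
  corners differ by at most 1 in each coordinate.\<close>

lemma AT_free_cubicity_le:
  fixes G :: "('a, 'b) pre_digraph"
  assumes "graph G" "AT_free G" "box_rep G b" "claw_number G \<le> 2 ^ t"
  shows "cubicity G \<le> b * (t + 2)"
proof -
  interpret graph G by (rule assms(1))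
  let ?V = "verts G"
  obtain F where F: "\<forall>v\<in>?V. axis_parallel_box b (F v)" "intersection_graph_of G F"
    using assms(3) unfolding box_rep_def by blast
  obtain l r :: "'a \<Rightarrow> nat \<Rightarrow> real" where lr: "\<And>v i. v \<in> ?V \<Longrightarrow> i < b \<Longrightarrow> l v i \<le> r v i"
    "\<And>v. v \<in> ?V \<Longrightarrow> F v = (\<Pi>\<^sub>E i\<in>{..<b}. {l v i..r v i})"
    using F(1) unfolding axis_parallel_box_def by metis
  have adj: "u \<rightarrow>\<^bsub>G\<^esub> v \<longleftrightarrow> (\<forall>i<b. l u i \<le> r v i \<and> l v i \<le> r u i)" if "u \<in> ?V" "v \<in> ?V" "u \<noteq> v" for u v
  proof -
    have "u \<rightarrow>\<^bsub>G\<^esub> v \<longleftrightarrow> F u \<inter> F v \<noteq> {}" using F(2) that unfolding intersection_graph_of_def by blast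
    also have "\<dots> \<longleftrightarrow> (\<forall>i<b. l u i \<le> r v i \<and> l v i \<le> r u i)"
      unfolding lr(2)[OF that(1)] lr(2)[OF that(2)]
      by (rule PiE_box_inter_nonempty) (use lr(1) that in auto)
    finally show ?thesis .
  qed
  define J where "J i u v \<longleftrightarrow> u \<in> ?V \<and> v \<in> ?V \<and> u \<noteq> v \<and> l u i \<le> r v i \<and> l v i \<le> r u i" for i u v
  define P where "P i f \<longleftrightarrow> (\<forall>u\<in>?V. \<forall>v\<in>?V. u \<noteq> v \<longrightarrow>
      (u \<rightarrow>\<^bsub>G\<^esub> v \<longrightarrow> (\<forall>j<t + 2. \<bar>f j u - f j v\<bar> \<le> 1)) \<and> ((\<forall>j<t + 2. \<bar>f j u - f j v\<bar> \<le> 1) \<longrightarrow> J i u v))"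
    for i and f :: "nat \<Rightarrow> 'a \<Rightarrow> real"
  have "\<exists>f. P i f" if i: "i < b" for i
    unfolding P_def
  proof (rule at_free_unit_functions[OF finite_verts symp_dominates irreflp_dominates
        AT_free_imp_at_free[OF assms(2)]])
    show sym: "symp (J i)" by (auto simp: symp_def J_def)
    show "irreflp (J i)" by (auto simp: irreflp_def J_def)
    have "interval_rep ?V (J i) (\<lambda>v. l v i) (\<lambda>v. r v i)"
      using lr(1) i by (intro interval_repI) (auto simp: J_def)
    then show "chordal ?V (J i)" by (rule interval_rep_chordal[OF sym])
    show "J i u v" if "u \<rightarrow>\<^bsub>G\<^esub> v" for u v
    proof -
      have "u \<in> ?V" "v \<in> ?V" "u \<noteq> v" using that adj_in_verts adj_not_same by blast+
      then show ?thesis using adj that i unfolding J_def by blast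
    qed
    show "card S \<le> 2 ^ t"
      if "u \<in> ?V" "S \<subseteq> ?V" "S \<noteq> {}" "\<forall>s\<in>S. u \<rightarrow>\<^bsub>G\<^esub> s" "\<forall>s\<in>S. \<forall>t\<in>S. \<not> s \<rightarrow>\<^bsub>G\<^esub> t" for u S
      using claw_le_claw_number[OF that] assms(4) by linarith
  qed
  then obtain f where f: "\<And>i. i < b \<Longrightarrow> P i (f i)" by metis
  \<comment> \<open>The pair \<open>(i, j)\<close> gets the number
    \<open>i * (t + 2) + j\<close>.\<close>
  define g where "g k v = f (k div (t + 2)) (k mod (t + 2)) v" for k v
  have g: "(\<forall>k<b * (t + 2). \<bar>g k u - g k v\<bar> \<le> 1) \<longleftrightarrow> (\<forall>i<b. \<forall>j<t + 2. \<bar>f i j u - f i j v\<bar> \<le> 1)" for u v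
  proof safe
    fix i j assume a: "\<forall>k<b * (t + 2). \<bar>g k u - g k v\<bar> \<le> 1" and ij: "i < b" "j < t + 2"
    have "i * (t + 2) + j < Suc i * (t + 2)" using ij by simp
    also have "\<dots> \<le> b * (t + 2)" using ij by (intro mult_le_mono1) simp
    finally have "\<bar>g (i * (t + 2) + j) u - g (i * (t + 2) + j) v\<bar> \<le> 1" using a by blast
    moreover have "(i * (t + 2) + j) div (t + 2) = i" "(i * (t + 2) + j) mod (t + 2) = j"
      using ij(2) by (auto simp del: add_2_eq_Suc' mult_Suc_right)
    ultimately show "\<bar>f i j u - f i j v\<bar> \<le> 1" unfolding g_def by simp
  next
    fix k assume a: "\<forall>i<b. \<forall>j<t + 2. \<bar>f i j u - f i j v\<bar> \<le> 1" "k < b * (t + 2)"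
    have "k div (t + 2) < b" using a(2) by (simp add: less_mult_imp_div_less)
    then show "\<bar>g k u - g k v\<bar> \<le> 1" unfolding g_def using a(1) by simp
  qed
  define C where "C v = (\<Pi>\<^sub>E k\<in>{..<b * (t + 2)}. {g k v..g k v + 1})" for v
  have "unit_cube (b * (t + 2)) (C v)" for v
    unfolding unit_cube_def C_def by (rule exI[of _ "\<lambda>k. g k v"]) simp
  moreover have "intersection_graph_of G C"
    unfolding intersection_graph_of_def
  proof (intro ballI impI)
    fix u v assume uv: "u \<in> ?V" "v \<in> ?V" "u \<noteq> v"
    have "C u \<inter> C v \<noteq> {} \<longleftrightarrow> (\<forall>k<b * (t + 2). g k u \<le> g k v + 1 \<and> g k v \<le> g k u + 1)"
      unfolding C_def
      by (rule PiE_box_inter_nonempty[of _ "\<lambda>k. g k u" "\<lambda>k. g k u + 1" "\<lambda>k. g k v" "\<lambda>k. g k v + 1"]) auto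
    also have "\<dots> \<longleftrightarrow> (\<forall>k<b * (t + 2). \<bar>g k u - g k v\<bar> \<le> 1)"
      by (auto simp: abs_le_iff algebra_simps)
    also have "\<dots> \<longleftrightarrow> u \<rightarrow>\<^bsub>G\<^esub> v"
    proof
      assume "\<forall>k<b * (t + 2). \<bar>g k u - g k v\<bar> \<le> 1"
      then have "J i u v" if "i < b" for i
        using f[OF that] uv that unfolding g P_def by blast
      then show "u \<rightarrow>\<^bsub>G\<^esub> v" using adj[OF uv] unfolding J_def by blast
    next
      assume "u \<rightarrow>\<^bsub>G\<^esub> v"
      then show "\<forall>k<b * (t + 2). \<bar>g k u - g k v\<bar> \<le> 1"
        using f uv unfolding g P_def by blast
    qed
    finally show "u \<rightarrow>\<^bsub>G\<^esub> v \<longleftrightarrow> C u \<inter> C v \<noteq> {}" by blast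
  qed
  ultimately show ?thesis
    unfolding cubicity_def by (intro Least_le) blast
qed

theorem theorem12:
  fixes G :: "('a, 'b) pre_digraph"
  assumes "graph G"
    and "AT_free G"
  shows "int (cubicity G) \<le> int (boxicity G) * (\<lceil>log 2 (real (claw_number G))\<rceil> + 2)
       \<and> int (boxicity G) * (\<lceil>log 2 (real (claw_number G))\<rceil> + 2)
           \<le> int (chromatic_number G) * (\<lceil>log 2 (real (claw_number G))\<rceil> + 2)"
proof -
  let ?p = "claw_number G"
  define t where "t = nat \<lceil>log 2 (real ?p)\<rceil>"
  \<comment> \<open>For an edgeless graph \<open>claw_number G = 0\<close> and \<open>log 2 0 = 0\<close>.\<close>
  have "0 \<le> log 2 (real ?p)" by (cases "?p = 0") (auto simp: log_def)
  then have t: "\<lceil>log 2 (real ?p)\<rceil> = int t" unfolding t_def by simp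
  have "?p \<le> 2 ^ t"
  proof (cases "?p = 0")
    case False
    have "log 2 (real ?p) \<le> real t" using t by linarith
    then have "real ?p \<le> 2 powr real t" using False by (simp add: log_le_iff)
    then have "real ?p \<le> real (2 ^ t)" by (simp add: powr_realpow)
    then show ?thesis by (simp only: of_nat_le_iff)
  qed simp
  \<comment> \<open>One box representation in dimension \<open>chromatic_number G\<close> shows both
    that the minimum is attained and that it is bounded by this dimension.\<close>
  moreover have "box_rep G (boxicity G)" "boxicity G \<le> chromatic_number G"
    using AT_free_box_rep_chromatic_number[OF assms]
    unfolding boxicity_def box_rep_def by (rule LeastI, rule Least_le)
  ultimately have "cubicity G \<le> boxicity G * (t + 2)" "boxicity G * (t + 2) \<le> chromatic_number G * (t + 2)"
    using AT_free_cubicity_le[OF assms] by (blast, intro mult_le_mono1)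
  then have "int (cubicity G) \<le> int (boxicity G * (t + 2))"
    "int (boxicity G * (t + 2)) \<le> int (chromatic_number G * (t + 2))"
    by (simp_all only: of_nat_le_iff)
  then show ?thesis unfolding t by (simp only: of_nat_mult of_nat_add of_nat_numeral)
qed

end
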